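(* For every integer $d\geq 2$, there exists a piecewise affine, globally continuous map $T:[0,1]^d\to[0,1]^d$ such that $$h_{\mathrm{top}}(T)=\sup_\mu h(T,\mu)=\log 2,$$ where the supremum is over all $T$-invariant Borel probability measures $\mu$ on $[0,1]^d$, and such that $T$ has no maximal entropy measure, i.e., there is no $T$-invariant Borel probability measure $\mu$ on $[0,1]^d$ with $h(T,\mu)=\log 2$.
   Context: A map $T:[0,1]^d\to[0,1]^d$ is called piecewise affine if there exists a finite partition of $[0,1]^d$ such that, for each element $A$ of the partition, the restriction $T|A$ is the restriction to $A$ of an affine map $\mathbb R^d\to\mathbb R^d$ (a linear map followed by a translation). "Globally continuous" means that $T$ is continuous on all of $[0,1]^d$. $h_{\mathrm{top}}(T)$ denotes the topological entropy of $T$, and $h(T,\mu)$ the Kolmogorov–Sinai (measure-theoretic) entropy of $T$ with respect to an invariant probability measure $\mu$; natural logarithms are used. A maximal entropy measure is a $T$-invariant Borel probability measure $\mu$ with $h(T,\mu)=h_{\mathrm{top}}(T)$. *)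

theory Defs
  imports "HOL-Analysis.Analysis" "HOL-Probability.Probability"
begin

abbreviation unit_cube :: "(real ^ 'n::finite) set" where
  "unit_cube \<equiv> cbox 0 1"

(* The pieces are arbitrary subsets, not necessarily polytopes. *)
definition piecewise_affine_on ::
    "'a::real_vector set \<Rightarrow> ('a \<Rightarrow> 'b::real_vector) \<Rightarrow> bool" where
  "piecewise_affine_on X T \<longleftrightarrow>
     (\<exists>P. finite P \<and> partition_on X P \<and>
        (\<forall>A\<in>P. \<exists>L c. linear L \<and> (\<forall>x\<in>A. T x = L x + c)))"

definition bowen_ball ::
    "('a::metric_space \<Rightarrow> 'a) \<Rightarrow> nat \<Rightarrow> real \<Rightarrow> 'a \<Rightarrow> 'a set" where
  "bowen_ball T n \<epsilon> x = {y. \<forall>k<n. dist ((T ^^ k) x) ((T ^^ k) y) < \<epsilon>}"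

definition spanning_set ::
    "('a::metric_space \<Rightarrow> 'a) \<Rightarrow> 'a set \<Rightarrow> nat \<Rightarrow> real \<Rightarrow> 'a set \<Rightarrow> bool" where
  "spanning_set T X n \<epsilon> E \<longleftrightarrow>
     finite E \<and> E \<subseteq> X \<and> X \<subseteq> (\<Union>x\<in>E. bowen_ball T n \<epsilon> x)"

(* Bowen-Dinaburg: sup over epsilon of limsup (1/n) log r(n, epsilon), where r(n, epsilon) is the
   minimal cardinality of a spanning set.  Since ln is monotone, the minimum is taken after the
   logarithm; the infimum is \<infinity> if there is no finite spanning set.  The value at n = 0 does not
   affect the limsup. *)
definition topological_entropy :: "('a::metric_space \<Rightarrow> 'a) \<Rightarrow> 'a set \<Rightarrow> ereal" where
  "topological_entropy T X =
     (SUP \<epsilon>\<in>{0<..}. limsup (\<lambda>n. INF E\<in>{E. spanning_set T X n \<epsilon> E}.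
        ereal (ln (real (card E)) / real n)))"

definition invariant_measures ::
    "('a::topological_space \<Rightarrow> 'a) \<Rightarrow> 'a set \<Rightarrow> 'a measure set" where
  "invariant_measures T X =
     {M. prob_space M \<and> sets M = sets (restrict_space borel X) \<and>
         T \<in> M \<rightarrow>\<^sub>M M \<and> distr M M T = M}"

definition measurable_partition :: "'a measure \<Rightarrow> 'a set set \<Rightarrow> bool" where
  "measurable_partition M P \<longleftrightarrow> finite P \<and> P \<subseteq> sets M \<and> partition_on (space M) P"

(* The convention 0 * ln 0 = 0 is automatic. *)
definition partition_entropy :: "'a measure \<Rightarrow> 'a set set \<Rightarrow> real" where
  "partition_entropy M P = - (\<Sum>A\<in>P. measure M A * ln (measure M A))"

(* The join of the partitions T^(-k) P of X, for k < n: its members are the nonempty n-cylinders. *)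
definition iterated_join ::
    "('a \<Rightarrow> 'a) \<Rightarrow> 'a set \<Rightarrow> 'a set set \<Rightarrow> nat \<Rightarrow> 'a set set" where
  "iterated_join T X P n =
     {{x \<in> X. \<forall>k<n. (T ^^ k) x \<in> A k} |A. \<forall>k<n. A k \<in> P} - {{}}"

(* For an invariant measure the sequence of partition entropies is subadditive, so the limsup
   is a limit. *)
definition entropy_wrt_partition ::
    "('a \<Rightarrow> 'a) \<Rightarrow> 'a measure \<Rightarrow> 'a set set \<Rightarrow> ereal" where
  "entropy_wrt_partition T M P =
     limsup (\<lambda>n. ereal (partition_entropy M (iterated_join T (space M) P n) / real n))"

definition ks_entropy :: "('a \<Rightarrow> 'a) \<Rightarrow> 'a measure \<Rightarrow> ereal" where
  "ks_entropy T M = (SUP P\<in>{P. measurable_partition M P}. entropy_wrt_partition T M P)"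

definition maximal_entropy_measure ::
    "('a::metric_space \<Rightarrow> 'a) \<Rightarrow> 'a set \<Rightarrow> 'a measure \<Rightarrow> bool" where
  "maximal_entropy_measure T X M \<longleftrightarrow>
     M \<in> invariant_measures T X \<and> ks_entropy T M = topological_entropy T X"

end

theory Submission
  imports Defs "HOL-Real_Asymp.Real_Asymp"
begin

text \<open>
  On the coordinates \<open>u = p $ i\<close> and \<open>v = p $ j\<close> (all others are sent to
  \<open>0\<close>) the map is a truncated cone map: in the sector \<open>u \<le> v/8\<close> it
  is \<open>(4u, v/2)\<close>, in the sector \<open>v/2 \<le> u \<le> v\<close> it is \<open>(4(v
  - u), 2v)\<close> cut off at \<open>1\<close>; the sector in between, where the height
  \<open>v\<close> is interpolated, is sent to the diagonal and then to the axis \<open>u =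
  0\<close>, on which everything contracts to the origin. Each of the two sectors covers the full
  cone in the direction \<open>u/v\<close>, so a nontrivial recurrent orbit is coded by an
  arbitrary sequence of coin tosses, while \<open>v\<close> performs the multiplicative walk
  \<open>v \<mapsto> v/2\<close> or \<open>v \<mapsto> min 1 (2v)\<close> driven by these coins.
  The height adds only polynomial complexity, so the entropy is at most \<open>ln 2\<close>.
  Equality would force the coins to be independent and fair; then the reflected random walk
  \<open>log v\<close> is null recurrent and has no stationary distribution, i.e. \<open>v =
  0\<close> almost surely, a contradiction. Coins biased towards increasing \<open>v\<close> do
  have stationary distributions (geometric ones), and their entropy tends to \<open>ln 2\<close>
  as the bias vanishes.
\<close>

section \<open>Entropy of finite labellings\<close>

text \<open>The constants fit together in the ratio \<open>u / v\<close>: the lower branch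
  multiplies it by 8 and the upper one sends it to \<open>2 * (1 - u / v)\<close>, so each sector is
  stretched over the whole range from 0 to 1. Where the height is cut off at 1, the part of the
  upper sector with \<open>4 * (v - u) \<le> 1\<close> still covers the cone. In both branches the
  inverse contracts \<open>u\<close> by 4, so coins and heights determine the point. The rate
  \<open>ln 2\<close> is only approached: walks confined below a level \<open>K\<close> grow like
  \<open>(2 * cos (pi / K)) ^ n\<close>, and letting \<open>K\<close> tend to infinity drives the
  orbits towards the origin, where the two sectors merge. The obstacle for strictness is that the
  entropy of a measure is a supremum over all measurable partitions. Every partition is therefore
  compared with finite words of coins and height cells, which bounds the entropy by
  \<open>H m / m\<close> for every block length \<open>m\<close>, where \<open>H m\<close> is the
  entropy of the first \<open>m\<close> coins. Entropy \<open>ln 2\<close> then forces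
  \<open>H m = m * ln 2\<close> for all \<open>m\<close>, that is, exactly uniform coin words, and
  null recurrence becomes a counting statement about words.\<close>

definition label_entropy :: "'a measure \<Rightarrow> ('a \<Rightarrow> 'b) \<Rightarrow> real" where
  "label_entropy M f =
     - (\<Sum>y\<in>f ` space M. measure M (f -` {y} \<inter> space M) * ln (measure M (f -` {y} \<inter> space M)))"

context prob_space
begin

text \<open>Base \<open>exp 1\<close> turns the logarithm of the information theory library into
  \<open>ln\<close>. This opens its chain rule and data processing inequality to entropies of
  partitions, with joins becoming pairs of labels.\<close>

lemma label_entropy_eq_entropy:
  assumes "simple_function M f"
  shows "label_entropy M f = entropy (exp 1) (count_space (f ` space M)) f"
proof -
  interpret information_space M "exp 1" by standard auto
  show ?thesis
    by (subst entropy_simple_distributed[OF simple_distributedI[OF assms measure_nonneg refl]])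
      (simp add: label_entropy_def log_def)
qed

lemma label_entropy_superset:
  assumes "finite S" "f ` space M \<subseteq> S"
  shows "label_entropy M f =
     - (\<Sum>y\<in>S. measure M (f -` {y} \<inter> space M) * ln (measure M (f -` {y} \<inter> space M)))"
proof -
  have "measure M (f -` {y} \<inter> space M) = 0" if "y \<notin> f ` space M" for y
  proof -
    have "f -` {y} \<inter> space M = {}" using that by auto
    thus ?thesis by simp
  qed
  thus ?thesis unfolding label_entropy_def neg_equal_iff_equal
    using assms by (intro sum.mono_neutral_left) auto
qed

lemma label_entropy_AE_cong:
  assumes f: "simple_function M f" and g: "simple_function M g" and "AE x in M. f x = g x"
  shows "label_entropy M f = label_entropy M g"
proof -
  let ?S = "f ` space M \<union> g ` space M"
  have fin: "finite ?S" using f g by (auto simp: simple_function_def)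
  have meas: "h -` {y} \<inter> space M \<in> sets M" if "simple_function M h" for h :: "'a \<Rightarrow> 'b" and y
    using that by (rule simple_functionD)
  have "measure M (f -` {y} \<inter> space M) = measure M (g -` {y} \<inter> space M)" for y
    using assms(3) meas[OF f] meas[OF g] by (intro measure_eq_AE) auto
  thus ?thesis
    using fin by (simp add: label_entropy_superset[of ?S])
qed

lemma label_entropy_Pair_le:
  assumes "simple_function M f" "simple_function M g"
  shows "label_entropy M (\<lambda>x. (f x, g x)) \<le> label_entropy M f + label_entropy M g"
proof -
  interpret information_space M "exp 1" by standard auto
  show ?thesis
    using entropy_chain_rule[OF assms] conditional_entropy_less_eq_entropy[OF assms(2,1)]
    by (simp add: label_entropy_eq_entropy assms simple_function_Pair)
qed

lemma label_entropy_comp_le: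
  assumes "simple_function M f"
  shows "label_entropy M (\<lambda>x. F (f x)) \<le> label_entropy M f"
proof -
  interpret information_space M "exp 1" by standard auto
  have "simple_function M (F \<circ> f)" using assms by (rule simple_function_compose)
  thus ?thesis
    using entropy_data_processing[OF assms, of F]
    by (simp add: label_entropy_eq_entropy assms o_def)
qed

text \<open>On \<open>A\<close> the label \<open>g\<close> factors through \<open>f\<close>: choose
  one representative in \<open>A\<close> for each value of \<open>f\<close>. Outside
  \<open>A\<close> the factorization may fail, but only on a null set.\<close>

lemma label_entropy_le_of_determined:
  assumes f: "simple_function M f" and g: "simple_function M g"
    and A: "AE x in M. x \<in> A"
    and det: "\<And>x y. x \<in> A \<Longrightarrow> y \<in> A \<Longrightarrow> f x = f y \<Longrightarrow> g x = g y"
  shows "label_entropy M g \<le> label_entropy M f"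
proof -
  define F where "F z = g (SOME x. x \<in> A \<and> f x = z)" for z
  have F: "g x = F (f x)" if "x \<in> A" for x
  proof -
    have "(SOME x'. x' \<in> A \<and> f x' = f x) \<in> A \<and> f (SOME x'. x' \<in> A \<and> f x' = f x) = f x"
      by (rule someI) (use that in auto)
    thus ?thesis unfolding F_def using det that by metis
  qed
  have "label_entropy M g = label_entropy M (\<lambda>x. F (f x))"
    using A F simple_function_compose[OF f, of F]
    by (intro label_entropy_AE_cong g) (auto simp: o_def elim: eventually_mono)
  also have "\<dots> \<le> label_entropy M f" by (rule label_entropy_comp_le[OF f])
  finally show ?thesis .
qed

lemma sum_prob_fibres:
  assumes f: "simple_function M f" and S: "finite S" "f ` space M \<subseteq> S"
  shows "(\<Sum>y\<in>S. prob (f -` {y} \<inter> space M)) = 1"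
proof -
  have "(\<Sum>y\<in>S. prob (f -` {y} \<inter> space M)) = prob (\<Union>y\<in>S. f -` {y} \<inter> space M)"
    using S f by (intro finite_measure_finite_Union[symmetric])
      (auto simp: disjoint_family_on_def simple_functionD)
  also have "(\<Union>y\<in>S. f -` {y} \<inter> space M) = space M" using S by auto
  finally show ?thesis by (simp add: prob_space)
qed

text \<open>Entropy is the mean of \<open>- ln q\<close> over the fibre masses \<open>q\<close>, and
  every fibre of positive mass has \<open>- ln q\<close> at least \<open>c\<close>.\<close>

lemma label_entropy_ge:
  assumes f: "simple_function M f"
    and le: "\<And>y. y \<in> f ` space M \<Longrightarrow> prob (f -` {y} \<inter> space M) \<le> exp (- c)"
  shows "c \<le> label_entropy M f"
proof -
  have fin: "finite (f ` space M)" using f by (simp add: simple_function_def)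
  define q where "q y = prob (f -` {y} \<inter> space M)" for y
  have "q y * c \<le> - (q y * ln (q y))" if "y \<in> f ` space M" for y
  proof (cases "q y = 0")
    case False
    hence "q y > 0" by (simp add: q_def zero_less_measure_iff)
    hence "ln (q y) \<le> - c" using le[OF that] unfolding q_def by (metis ln_exp ln_mono exp_gt_zero)
    hence "q y * ln (q y) \<le> q y * (- c)" using \<open>q y > 0\<close> by (intro mult_left_mono) auto
    thus ?thesis by simp
  qed simp
  hence "(\<Sum>y\<in>f ` space M. q y * c) \<le> (\<Sum>y\<in>f ` space M. - (q y * ln (q y)))" by (rule sum_mono)
  moreover have "(\<Sum>y\<in>f ` space M. q y) = 1"
    unfolding q_def by (rule sum_prob_fibres[OF f fin order_refl])
  ultimately show ?thesis
    by (simp add: label_entropy_def q_def sum_negf flip: sum_distrib_right)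
qed

text \<open>The difference \<open>ln N - H(f)\<close> is a sum of terms \<open>q (x - 1 - ln x)\<close> with \<open>x = 1 / (N q)\<close>,
  which is nonnegative and vanishes only for \<open>x = 1\<close>.\<close>
lemma
  assumes f: "simple_function M f" and S: "finite S" "f ` space M \<subseteq> S"
  shows label_entropy_le_card: "label_entropy M f \<le> ln (card S)"
    and label_entropy_eq_card:
      "label_entropy M f = ln (card S) \<Longrightarrow> y \<in> S \<Longrightarrow> prob (f -` {y} \<inter> space M) = 1 / card S"
proof -
  define N :: real where "N = card S"
  define q where "q y = prob (f -` {y} \<inter> space M)" for y
  define gap where "gap y = 1 / N - q y + q y * ln (q y) + q y * ln N" for y
  have "S \<noteq> {}" using S not_empty by auto
  hence N: "N > 0" unfolding N_def using S by (simp add: card_gt_0_iff)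
  have q0: "q y \<ge> 0" for y by (simp add: q_def)
  have q1: "(\<Sum>y\<in>S. q y) = 1" unfolding q_def by (rule sum_prob_fibres[OF f S])
  have gapsum: "(\<Sum>y\<in>S. gap y) = ln N - label_entropy M f"
  proof -
    have "(\<Sum>y\<in>S. gap y) = N * (1 / N) - (\<Sum>y\<in>S. q y) + (\<Sum>y\<in>S. q y * ln (q y)) + (\<Sum>y\<in>S. q y) * ln N"
      unfolding gap_def by (simp add: sum.distrib sum_subtractf sum_distrib_right N_def)
    also have "(\<Sum>y\<in>S. q y * ln (q y)) = - label_entropy M f"
      by (subst label_entropy_superset[OF S]) (simp add: q_def)
    finally show ?thesis using q1 N by simp
  qed
  have gap_eq: "gap y = q y * (1 / (N * q y) - 1 - ln (1 / (N * q y)))" if "q y > 0" for y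
    using that N by (simp add: gap_def field_simps ln_mult ln_div)
  have gap0: "gap y \<ge> 0" for y
  proof (cases "q y = 0")
    case False
    hence q: "q y > 0" using q0[of y] by simp
    have "ln (1 / (N * q y)) \<le> 1 / (N * q y) - 1"
      using q N by (intro ln_le_minus_one) auto
    thus ?thesis unfolding gap_eq[OF q] using q by simp
  qed (use N in \<open>simp add: gap_def\<close>)
  show "label_entropy M f \<le> ln (card S)"
    using gapsum sum_nonneg[of S gap] gap0 by (simp add: N_def)
  assume eq: "label_entropy M f = ln (card S)" and y: "y \<in> S"
  hence "(\<Sum>y\<in>S. gap y) = 0" using gapsum by (simp add: N_def)
  hence g: "gap y = 0" using sum_nonneg_eq_0_iff[of S gap] gap0 S y by auto
  hence q: "q y > 0" using q0[of y] N by (cases "q y = 0") (auto simp: gap_def)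
  have "ln (1 / (N * q y)) = 1 / (N * q y) - 1" using g q unfolding gap_eq[OF q] by simp
  hence "1 / (N * q y) = 1" using q N by (intro ln_eq_minus_one) auto
  thus "prob (f -` {y} \<inter> space M) = 1 / card S"
    using q N by (simp add: q_def N_def field_simps)
qed

end

section \<open>Itineraries and their subadditive entropy under an invariant measure\<close>

definition itinerary :: "('a \<Rightarrow> 'a) \<Rightarrow> ('a \<Rightarrow> 'b) \<Rightarrow> nat \<Rightarrow> 'a \<Rightarrow> 'b list" where
  "itinerary T f n x = map (\<lambda>k. f ((T ^^ k) x)) [0..<n]"

lemma length_itinerary [simp]: "length (itinerary T f n x) = n"
  by (simp add: itinerary_def)

lemma nth_itinerary [simp]: "k < n \<Longrightarrow> itinerary T f n x ! k = f ((T ^^ k) x)"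
  by (simp add: itinerary_def)

lemma itinerary_eq_iff:
  "itinerary T f n x = itinerary T f n y \<longleftrightarrow> (\<forall>k<n. f ((T ^^ k) x) = f ((T ^^ k) y))"
  by (auto simp: list_eq_iff_nth_eq)

lemma itinerary_0 [simp]: "itinerary T f 0 x = []"
  by (simp add: itinerary_def)

lemma itinerary_Suc: "itinerary T f (Suc n) x = itinerary T f n x @ [f ((T ^^ n) x)]"
  by (simp add: itinerary_def)

lemma itinerary_add: "itinerary T f (a + b) x = itinerary T f a x @ itinerary T f b ((T ^^ a) x)"
proof (induction b)
  case (Suc b)
  have "(T ^^ b) ((T ^^ a) x) = (T ^^ (a + b)) x"
    by (metis add.commute funpow_add comp_apply)
  with Suc show ?case by (simp add: itinerary_Suc)
qed simp

locale invariant_system = prob_space M for M :: "'a measure" +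
  fixes T :: "'a \<Rightarrow> 'a"
  assumes measurable_T [measurable]: "T \<in> M \<rightarrow>\<^sub>M M"
    and distr_T: "distr M M T = M"
begin

lemma measurable_funpow [measurable]: "T ^^ k \<in> M \<rightarrow>\<^sub>M M"
  by (induction k) auto

lemma distr_funpow: "distr M M (T ^^ k) = M"
proof (induction k)
  case (Suc k)
  have "distr M M (T ^^ Suc k) = distr (distr M M (T ^^ k)) M T"
    by (subst distr_distr) auto
  thus ?case by (simp only: Suc distr_T)
qed (simp add: distr_id2 id_def)

lemma funpow_space: "x \<in> space M \<Longrightarrow> (T ^^ k) x \<in> space M"
  using measurable_space[OF measurable_funpow] .

lemma prob_funpow_vimage:
  assumes "A \<in> sets M"
  shows "prob ((T ^^ k) -` A \<inter> space M) = prob A"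
proof -
  have "prob A = measure (distr M M (T ^^ k)) A" by (simp add: distr_funpow)
  also have "\<dots> = prob ((T ^^ k) -` A \<inter> space M)" using assms by (simp add: measure_distr)
  finally show ?thesis by simp
qed

lemma AE_funpow: "AE x in M. P x \<Longrightarrow> AE x in M. P ((T ^^ k) x)"
  using AE_distrD[of "T ^^ k" M M P] unfolding distr_funpow by simp

lemma simple_function_funpow:
  assumes "simple_function M f"
  shows "simple_function M (\<lambda>x. f ((T ^^ k) x))"
proof -
  have "(\<lambda>x. f ((T ^^ k) x)) ` space M \<subseteq> f ` space M" using funpow_space by auto
  hence "finite ((\<lambda>x. f ((T ^^ k) x)) ` space M)"
    using assms finite_subset unfolding simple_function_def by blast
  moreover have "(\<lambda>x. f ((T ^^ k) x)) -` {y} \<inter> space M \<in> sets M" for y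
  proof -
    have "(\<lambda>x. f ((T ^^ k) x)) -` {y} \<inter> space M = (T ^^ k) -` (f -` {y} \<inter> space M) \<inter> space M"
      using funpow_space by auto
    thus ?thesis using measurable_sets[OF measurable_funpow simple_functionD(2)[OF assms]] by (simp only:)
  qed
  ultimately show ?thesis by (simp add: simple_function_def)
qed

lemma label_entropy_funpow:
  assumes "simple_function M f"
  shows "label_entropy M (\<lambda>x. f ((T ^^ k) x)) = label_entropy M f"
proof -
  have "prob ((\<lambda>x. f ((T ^^ k) x)) -` {y} \<inter> space M) = prob (f -` {y} \<inter> space M)" for y
  proof -
    have "(\<lambda>x. f ((T ^^ k) x)) -` {y} \<inter> space M = (T ^^ k) -` (f -` {y} \<inter> space M) \<inter> space M"
      using funpow_space by auto
    thus ?thesis using prob_funpow_vimage[OF simple_functionD(2)[OF assms]] by (simp only:)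
  qed
  moreover have "finite (f ` space M)" using assms by (simp add: simple_function_def)
  ultimately show ?thesis
    using funpow_space by (subst (1 2) label_entropy_superset[of "f ` space M"]) auto
qed

lemma simple_function_itinerary:
  assumes "simple_function M f"
  shows "simple_function M (itinerary T f n)"
proof (induction n)
  case (Suc n)
  have "simple_function M (\<lambda>x. (\<lambda>(xs, y). xs @ [y]) (itinerary T f n x, f ((T ^^ n) x)))"
    by (rule simple_function_compose1[OF simple_function_Pair[OF Suc simple_function_funpow[OF assms]]])
  moreover have "(\<lambda>x. (\<lambda>(xs, y). xs @ [y]) (itinerary T f n x, f ((T ^^ n) x))) = itinerary T f (Suc n)"
    by (auto simp: itinerary_Suc)
  ultimately show ?case by simp
qed (auto simp: simple_function_def)

text \<open>Cut the word after \<open>a\<close> letters; by invariance the second block is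
  distributed like a word of length \<open>b\<close> starting at time 0.\<close>

lemma label_entropy_itinerary_add:
  assumes "simple_function M f"
  shows "label_entropy M (itinerary T f (a + b))
       \<le> label_entropy M (itinerary T f a) + label_entropy M (itinerary T f b)"
proof -
  note s = simple_function_itinerary[OF assms]
  have "label_entropy M (itinerary T f (a + b))
      \<le> label_entropy M (\<lambda>x. (itinerary T f a x, itinerary T f b ((T ^^ a) x)))"
    by (rule label_entropy_le_of_determined[where A = UNIV])
      (auto simp: s simple_function_Pair simple_function_funpow[OF s] itinerary_add)
  also have "\<dots> \<le> label_entropy M (itinerary T f a)
      + label_entropy M (\<lambda>x. itinerary T f b ((T ^^ a) x))"
    by (rule label_entropy_Pair_le[OF s simple_function_funpow[OF s]])
  also have "label_entropy M (\<lambda>x. itinerary T f b ((T ^^ a) x)) = label_entropy M (itinerary T f b)"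
    by (rule label_entropy_funpow[OF s])
  finally show ?thesis .
qed

lemma label_entropy_itinerary_0: "label_entropy M (itinerary T f 0) = 0"
proof -
  have "label_entropy M (\<lambda>x. []) = 0"
    using not_empty by (subst label_entropy_superset[of "{[]}"]) (auto simp: vimage_def prob_space)
  moreover have "itinerary T f 0 = (\<lambda>x. [])" by auto
  ultimately show ?thesis by metis
qed

lemma label_entropy_itinerary_mult:
  assumes "simple_function M f"
  shows "label_entropy M (itinerary T f (q * m)) \<le> q * label_entropy M (itinerary T f m)"
proof (induction q)
  case (Suc q)
  have "label_entropy M (itinerary T f (Suc q * m))
     \<le> label_entropy M (itinerary T f m) + label_entropy M (itinerary T f (q * m))"
    using label_entropy_itinerary_add[OF assms, of m "q * m"] by simp
  with Suc show ?case by (simp add: algebra_simps)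
qed (simp add: label_entropy_itinerary_0 del: itinerary_0)

lemma label_entropy_itinerary_le:
  assumes "simple_function M f"
  shows "label_entropy M (itinerary T f n) \<le> n * label_entropy M f"
proof -
  have "label_entropy M (itinerary T f 1) \<le> label_entropy M f"
    by (rule label_entropy_le_of_determined[where A = UNIV])
      (auto simp: assms simple_function_itinerary[OF assms, of 1, simplified] itinerary_Suc)
  hence "n * label_entropy M (itinerary T f 1) \<le> n * label_entropy M f"
    by (rule mult_left_mono) simp
  with label_entropy_itinerary_mult[OF assms, of n 1] show ?thesis by simp
qed

end

section \<open>Finite partitions as labellings\<close>

definition cell_of :: "'a set set \<Rightarrow> 'a \<Rightarrow> 'a set" where
  "cell_of P x = (THE A. A \<in> P \<and> x \<in> A)"

lemma cell_of_eq:
  assumes "partition_on X P" "A \<in> P" "x \<in> A"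
  shows "cell_of P x = A"
  unfolding cell_of_def
proof (rule the_equality)
  fix B assume "B \<in> P \<and> x \<in> B"
  thus "B = A" using assms unfolding partition_on_def disjoint_def by blast
qed (use assms in auto)

lemma cell_of_in:
  assumes "partition_on X P" "x \<in> X"
  shows "cell_of P x \<in> P" "x \<in> cell_of P x"
proof -
  obtain A where "A \<in> P" "x \<in> A" using assms unfolding partition_on_def by blast
  thus "cell_of P x \<in> P" "x \<in> cell_of P x" using cell_of_eq[OF assms(1)] by auto
qed

context invariant_system
begin

lemma simple_function_cell_of:
  assumes "measurable_partition M P"
  shows "simple_function M (cell_of P)"
proof -
  have P: "finite P" "P \<subseteq> sets M" "partition_on (space M) P"
    using assms by (auto simp: measurable_partition_def)
  have sub: "cell_of P ` space M \<subseteq> P" using cell_of_in[OF P(3)] by auto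
  have "cell_of P -` {A} \<inter> space M = A" if "A \<in> P" for A
  proof -
    have "A \<subseteq> space M" using that P by (auto simp: partition_on_def)
    thus ?thesis using cell_of_in[OF P(3)] cell_of_eq[OF P(3) that] by auto
  qed
  hence "cell_of P -` {A} \<inter> space M \<in> sets M" if "A \<in> cell_of P ` space M" for A
    using that sub P(2) by (metis subsetD)
  thus ?thesis unfolding simple_function_def
    using finite_subset[OF sub P(1)] by blast
qed

text \<open>Since cells are disjoint, a nonempty cylinder determines its sequence of cells.
  Discarding the empty cylinders corresponds to keeping only the words that occur.\<close>

lemma iterated_join_eq_fibres:
  assumes "partition_on (space M) P"
  shows "iterated_join T (space M) P n
       = (\<lambda>w. itinerary T (cell_of P) n -` {w} \<inter> space M) ` itinerary T (cell_of P) n ` space M"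
    (is "?L = ?R")
proof -
  have fib: "itinerary T (cell_of P) n -` {itinerary T (cell_of P) n x} \<inter> space M
      = {y \<in> space M. \<forall>k<n. (T ^^ k) y \<in> cell_of P ((T ^^ k) x)}" if "x \<in> space M" for x
  proof -
    have "cell_of P ((T ^^ k) y) = cell_of P ((T ^^ k) x) \<longleftrightarrow> (T ^^ k) y \<in> cell_of P ((T ^^ k) x)"
      if y: "y \<in> space M" for k y
    proof -
      have "cell_of P ((T ^^ k) x) \<in> P" "(T ^^ k) y \<in> cell_of P ((T ^^ k) y)"
        using cell_of_in[OF assms] funpow_space[OF y] funpow_space[OF \<open>x \<in> space M\<close>] by blast+
      thus ?thesis using cell_of_eq[OF assms] by metis
    qed
    thus ?thesis by (auto simp: itinerary_eq_iff)
  qed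
  show ?thesis
  proof (intro equalityI subsetI)
    fix B assume "B \<in> ?L"
    then obtain A where A: "B = {x \<in> space M. \<forall>k<n. (T ^^ k) x \<in> A k}" "\<forall>k<n. A k \<in> P" "B \<noteq> {}"
      by (auto simp: iterated_join_def)
    then obtain x where x: "x \<in> space M" "\<forall>k<n. (T ^^ k) x \<in> A k" by auto
    have "A k = cell_of P ((T ^^ k) x)" if "k < n" for k
      using cell_of_eq[OF assms, of "A k"] A x that by auto
    hence "B = itinerary T (cell_of P) n -` {itinerary T (cell_of P) n x} \<inter> space M"
      unfolding fib[OF x(1)] A(1) by auto
    thus "B \<in> ?R" using x by auto
  next
    fix B assume "B \<in> ?R"
    then obtain x where x: "x \<in> space M"
      and "B = itinerary T (cell_of P) n -` {itinerary T (cell_of P) n x} \<inter> space M" by blast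
    hence "B = {y \<in> space M. \<forall>k<n. (T ^^ k) y \<in> cell_of P ((T ^^ k) x)}"
      by (simp only: fib)
    note x = x this
    moreover have "x \<in> B" using x cell_of_in[OF assms] funpow_space by auto
    moreover have "\<forall>k<n. cell_of P ((T ^^ k) x) \<in> P"
      using cell_of_in[OF assms] funpow_space x(1) by auto
    ultimately show "B \<in> ?L" unfolding iterated_join_def x(2)
      by (intro DiffI CollectI exI[of _ "\<lambda>k. cell_of P ((T ^^ k) x)"]) auto
  qed
qed

lemma partition_entropy_iterated_join:
  assumes "partition_on (space M) P"
  shows "partition_entropy M (iterated_join T (space M) P n)
       = label_entropy M (itinerary T (cell_of P) n)"
  unfolding partition_entropy_def label_entropy_def iterated_join_eq_fibres[OF assms]
  \<comment> \<open>Fibres over words that occur are nonempty and disjoint, so distinct words give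
    distinct cylinders.\<close>
  by (subst sum.reindex) (auto simp: inj_on_def)

end

section \<open>The cone map\<close>

lemma mem_unit_cube: "p \<in> unit_cube \<longleftrightarrow> (\<forall>k. 0 \<le> p $ k \<and> p $ k \<le> 1)"
  by (auto simp: mem_box_cart)

text \<open>Pieces may be arbitrary sets, so it suffices to choose at each point one of finitely
  many affine maps that agrees with \<open>T\<close> there, and to group the points by this
  choice.\<close>

lemma piecewise_affine_onI:
  assumes "finite F"
    and affine: "\<And>g. g \<in> F \<Longrightarrow> \<exists>L c. linear L \<and> (\<forall>x. g x = L x + c)"
    and cover: "\<And>x. x \<in> X \<Longrightarrow> \<exists>g\<in>F. T x = g x"
  shows "piecewise_affine_on X T"
proof -
  define g where "g x = (SOME g. g \<in> F \<and> T x = g x)" for x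
  have g: "g x \<in> F" "T x = g x x" if "x \<in> X" for x
  proof -
    have "\<exists>h. h \<in> F \<and> T x = h x" using cover[OF that] by blast
    from someI_ex[OF this] show "g x \<in> F" "T x = g x x" by (simp_all add: g_def)
  qed
  define P where "P = (\<lambda>h. {x \<in> X. g x = h}) ` F - {{}}"
  have "finite P" using assms(1) by (simp add: P_def)
  moreover have "partition_on X P"
    unfolding partition_on_def disjoint_def P_def using g(1) by auto
  moreover have "\<exists>L c. linear L \<and> (\<forall>x\<in>A. T x = L x + c)" if A: "A \<in> P" for A
  proof -
    obtain h where h: "h \<in> F" "A = {x \<in> X. g x = h}" using A unfolding P_def by blast
    obtain L c where "linear L" "\<forall>x. h x = L x + c" using affine[OF h(1)] by blast
    thus ?thesis using h(2) g(2) by auto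
  qed
  ultimately show ?thesis unfolding piecewise_affine_on_def by blast
qed

locale cone_map =
  fixes i j :: "'n::finite"
  assumes i_neq_j: "i \<noteq> j"
begin

text \<open>Writing the map with \<open>min\<close> and \<open>max\<close> makes continuity and
  piecewise affinity visible. For \<open>0 \<le> u \<le> v\<close> the first coordinate is a clipped
  tent; for \<open>v \<ge> 0\<close> the inner part of the second is \<open>v / 2\<close> when
  \<open>u \<le> v / 8\<close>, then \<open>4 * u\<close> until \<open>u = v / 2\<close>, then
  \<open>2 * v\<close>.\<close>

definition T :: "real ^ 'n \<Rightarrow> real ^ 'n" where
  "T p = (\<chi> k. if k = i then max 0 (min 1 (4 * min (p $ i) (p $ j - p $ i)))
               else if k = j then min 1 (max (p $ j / 2) (min (4 * p $ i) (2 * p $ j)))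
               else 0)"

lemma T_i: "T p $ i = max 0 (min 1 (4 * min (p $ i) (p $ j - p $ i)))"
  and T_j: "T p $ j = min 1 (max (p $ j / 2) (min (4 * p $ i) (2 * p $ j)))"
  and T_other: "k \<noteq> i \<Longrightarrow> k \<noteq> j \<Longrightarrow> T p $ k = 0"
  using i_neq_j by (auto simp: T_def)

lemma cubeD: "p \<in> unit_cube \<Longrightarrow> 0 \<le> p $ k" "p \<in> unit_cube \<Longrightarrow> p $ k \<le> 1"
  for p :: "real ^ 'n"
  by (auto simp: mem_unit_cube)

lemma dist_le_coords:
  fixes p q :: "real ^ 'n"
  assumes "\<And>k. k \<noteq> i \<Longrightarrow> k \<noteq> j \<Longrightarrow> p $ k = q $ k"
  shows "dist p q \<le> \<bar>p $ i - q $ i\<bar> + \<bar>p $ j - q $ j\<bar>"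
proof -
  have "dist p q \<le> (\<Sum>k\<in>UNIV. \<bar>(p - q) $ k\<bar>)" unfolding dist_norm by (rule norm_le_l1_cart)
  also have "\<dots> = (\<Sum>k\<in>{i, j}. \<bar>(p - q) $ k\<bar>)"
    using assms by (intro sum.mono_neutral_right) auto
  also have "\<dots> = \<bar>p $ i - q $ i\<bar> + \<bar>p $ j - q $ j\<bar>" using i_neq_j by simp
  finally show ?thesis .
qed

lemma T_in_cube: "p \<in> unit_cube \<Longrightarrow> T p \<in> unit_cube"
proof -
  assume "p \<in> unit_cube"
  hence "0 \<le> p $ i" "0 \<le> p $ j" by (auto simp: cubeD)
  thus ?thesis by (auto simp: mem_unit_cube T_def)
qed

lemma funpow_T_in_cube: "p \<in> unit_cube \<Longrightarrow> (T ^^ k) p \<in> unit_cube"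
  by (induction k) (auto simp del: mem_box_cart intro: T_in_cube)

lemma continuous_T: "continuous_on A T"
proof -
  have "continuous_on A (\<lambda>p. T p $ k)" for k
    unfolding T_def
    by (cases "k = i"; cases "k = j") (auto intro!: continuous_intros)
  hence "continuous_on A (\<lambda>p. \<chi> k. T p $ k)" by (rule continuous_on_vec_lambda)
  thus ?thesis by (simp add: vec_lambda_eta)
qed

lemma piecewise_affine_T: "piecewise_affine_on X T"
proof -
  define af where "af a b c p = a * p $ i + b * p $ j + c" for a b c :: real and p :: "real ^ 'n"
  \<comment> \<open>Each active coordinate has four affine candidates, one per argument of its
    \<open>min\<close> and \<open>max\<close>; \<open>F\<close> collects the sixteen
    combinations.\<close>
  define F where "F = (\<lambda>(f, g) p. \<chi> k. if k = i then f p else if k = j then g p else 0) `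
     ({af 0 0 0, af 0 0 1, af 4 0 0, af (-4) 4 0} \<times> {af 0 0 1, af 0 (1/2) 0, af 4 0 0, af 0 2 0})"
  show ?thesis
  proof (rule piecewise_affine_onI[of F])
    show "finite F" unfolding F_def by simp
  next
    fix h :: "real ^ 'n \<Rightarrow> real ^ 'n" assume "h \<in> F"
    then obtain a b c a' b' c' where
      h: "h = (\<lambda>p. \<chi> k. if k = i then af a b c p else if k = j then af a' b' c' p else 0)"
      unfolding F_def by auto
    define L where "L p = (\<chi> k. if k = i then a * p $ i + b * p $ j
         else if k = j then a' * p $ i + b' * p $ j else 0)" for p :: "real ^ 'n"
    have "linear L"
      by (rule linearI) (auto simp: L_def vec_eq_iff algebra_simps)
    moreover have "\<forall>x. h x = L x + (\<chi> k. if k = i then c else if k = j then c' else 0)"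
      by (auto simp: h L_def vec_eq_iff af_def)
    ultimately show "\<exists>L c. linear L \<and> (\<forall>x. h x = L x + c)" by blast
  next
    fix p
    have "\<exists>f\<in>{af 0 0 0, af 0 0 1, af 4 0 0, af (-4) 4 0}. T p $ i = f p"
      unfolding T_i by (auto simp: af_def max_def min_def)
    moreover have "\<exists>g\<in>{af 0 0 1, af 0 (1/2) 0, af 4 0 0, af 0 2 0}. T p $ j = g p"
      unfolding T_j by (auto simp: af_def max_def min_def)
    ultimately obtain f g where fg:
      "f \<in> {af 0 0 0, af 0 0 1, af 4 0 0, af (-4) 4 0}" "T p $ i = f p"
      "g \<in> {af 0 0 1, af 0 (1/2) 0, af 4 0 0, af 0 2 0}" "T p $ j = g p" by blast
    have "T p = (\<chi> k. if k = i then f p else if k = j then g p else 0)"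
      using fg(2,4) by (auto simp: vec_eq_iff T_other)
    thus "\<exists>h\<in>F. T p = h p" unfolding F_def using fg(1,3)
      by (intro bexI[of _ "(\<lambda>(f, g) p. \<chi> k. if k = i then f p else if k = j then g p else 0) (f, g)"])
        (auto intro!: imageI)
  qed
qed

section \<open>Regular points and the two affine branches\<close>

definition upper :: "real ^ 'n \<Rightarrow> bool" where
  "upper p \<longleftrightarrow> p $ j / 2 \<le> p $ i"

text \<open>These are the points of the two sectors whose first coordinate is not clipped: there
  \<open>u\<close> is given by an invertible affine branch at fixed height, the image lies again in
  the cone \<open>u \<le> v\<close>, and only the height can be cut off. The axis
  \<open>u = 0\<close> is included.\<close>

definition regular :: "real ^ 'n \<Rightarrow> bool" where
  "regular p \<longleftrightarrow> (if upper p then 0 \<le> p $ j - p $ i \<and> 4 * (p $ j - p $ i) \<le> 1 else 8 * p $ i \<le> p $ j)"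

lemma T_upper:
  assumes "p \<in> unit_cube" "regular p" "upper p"
  shows "T p $ i = 4 * (p $ j - p $ i)" "T p $ j = min 1 (2 * p $ j)"
proof -
  have h: "p $ j \<le> 2 * p $ i" "0 \<le> p $ j - p $ i" "4 * (p $ j - p $ i) \<le> 1" "0 \<le> p $ j"
    using assms cubeD[of p j] by (auto simp: regular_def upper_def)
  hence "min (p $ i) (p $ j - p $ i) = p $ j - p $ i" by (intro min_absorb2) linarith
  thus "T p $ i = 4 * (p $ j - p $ i)" unfolding T_i using h by simp
  have "min (4 * p $ i) (2 * p $ j) = 2 * p $ j" using h by (intro min_absorb2) linarith
  thus "T p $ j = min 1 (2 * p $ j)" unfolding T_j using h by simp
qed

lemma T_lower:
  assumes "p \<in> unit_cube" "regular p" "\<not> upper p"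
  shows "T p $ i = 4 * p $ i" "T p $ j = p $ j / 2"
proof -
  have h: "8 * p $ i \<le> p $ j" "0 \<le> p $ i" "p $ j \<le> 1"
    using assms cubeD[of p] by (auto simp: regular_def)
  hence "min (p $ i) (p $ j - p $ i) = p $ i" by (intro min_absorb1) linarith
  thus "T p $ i = 4 * p $ i" unfolding T_i using h by simp
  have "min (4 * p $ i) (2 * p $ j) = 4 * p $ i" using h by (intro min_absorb1) linarith
  thus "T p $ j = p $ j / 2" unfolding T_j using h by simp
qed

lemma T_diagonal:
  assumes "p \<in> unit_cube" "p $ j \<le> p $ i"
  shows "T p $ i = 0"
  using assms cubeD[of p i] unfolding T_i by simp

lemma T_axis:
  assumes "p \<in> unit_cube" "p $ i = 0"
  shows "T p $ i = 0" "T p $ j = p $ j / 2" "regular p"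
  using assms cubeD[of p j] unfolding T_i T_j regular_def upper_def
  by (auto simp: min_def max_def)

text \<open>Three cases: between the sectors both image coordinates are
  \<open>min 1 (4 * p $ i)\<close>; on or beyond the diagonal the image is already on the axis; a
  clipped point goes to height and position 1. Diagonal images reach the axis one step
  later.\<close>

lemma T_irregular:
  assumes "p \<in> unit_cube" "\<not> regular p"
  shows "T (T p) $ i = 0"
proof (cases "upper p")
  case False
  hence h: "p $ i < p $ j / 2" "p $ j / 2 < 4 * p $ i"
    using assms(2) by (auto simp: regular_def upper_def)
  have "min (p $ i) (p $ j - p $ i) = p $ i" "min (4 * p $ i) (2 * p $ j) = 4 * p $ i"
    using h by (auto intro!: min_absorb1)
  hence "T p $ i = min 1 (4 * p $ i)" "T p $ j = min 1 (4 * p $ i)"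
    unfolding T_i T_j using h cubeD(1)[OF assms(1), of i] by simp_all
  thus ?thesis using T_diagonal[OF T_in_cube[OF assms(1)]] by simp
next
  case True
  show ?thesis
  proof (cases "p $ j \<le> p $ i")
    case True
    thus ?thesis using T_diagonal[OF assms(1)] T_axis T_in_cube[OF assms(1)] by blast
  next
    case F: False
    hence h: "1 < 4 * (p $ j - p $ i)" "p $ j \<le> 2 * p $ i"
      using True assms(2) by (auto simp: regular_def upper_def)
    have "min (4 * p $ i) (2 * p $ j) = 2 * p $ j" using h by (intro min_absorb2) linarith
    hence "T p $ j = 1" unfolding T_j using h cubeD(1)[OF assms(1), of j] by simp
    moreover have "T p $ i = 1" unfolding T_i using h by simp
    ultimately show ?thesis using T_diagonal[OF T_in_cube[OF assms(1)]] by simp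
  qed
qed

lemma funpow_T_axis:
  assumes "p \<in> unit_cube" "p $ i = 0"
  shows "(T ^^ k) p $ i = 0 \<and> (T ^^ k) p $ j = p $ j / 2 ^ k"
proof (induction k)
  case (Suc k)
  thus ?case using T_axis[OF funpow_T_in_cube[OF assms(1)], of k] by simp
qed (use assms in auto)

lemma funpow_T_irregular:
  assumes "p \<in> unit_cube" "\<not> regular p" "k \<ge> 2"
  shows "(T ^^ k) p $ i = 0"
proof -
  obtain l where l: "k = l + 2" using assms(3) by (metis add.commute le_Suc_ex)
  have "(T ^^ k) p = (T ^^ l) (T (T p))" unfolding l funpow_add by (simp add: numeral_2_eq_2)
  thus ?thesis using funpow_T_axis[of "T (T p)" l] T_irregular[OF assms(1,2)] assms(1) T_in_cube by simp
qed

text \<open>At regular points the next height depends only on the symbol and the present height,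
  through the nondecreasing maps \<open>v / 2\<close> and \<open>min 1 (2 * v)\<close>.\<close>

lemma height_mono:
  assumes "p \<in> unit_cube" "q \<in> unit_cube" "p $ j \<le> q $ j"
    and "\<forall>k<m. regular ((T ^^ k) p) \<and> regular ((T ^^ k) q) \<and> upper ((T ^^ k) p) = upper ((T ^^ k) q)"
  shows "(T ^^ m) p $ j \<le> (T ^^ m) q $ j"
  using assms(4)
proof (induction m)
  case (Suc m)
  let ?p = "(T ^^ m) p" and ?q = "(T ^^ m) q"
  have IH: "?p $ j \<le> ?q $ j" using Suc by auto
  have *: "?p \<in> unit_cube" "?q \<in> unit_cube" using assms funpow_T_in_cube by auto
  have r: "regular ?p" "regular ?q" "upper ?p = upper ?q" using Suc.prems by auto
  show ?case
    using T_upper[OF *(1) r(1)] T_upper[OF *(2) r(2)] T_lower[OF *(1) r(1)] T_lower[OF *(2) r(2)] IH r(3)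
    by (cases "upper ?p") auto
qed (use assms in auto)

text \<open>The inverse branches contract the first coordinate by the factor 4.\<close>
lemma position_contraction:
  assumes "p \<in> unit_cube" "q \<in> unit_cube" "\<delta> \<ge> 0"
    and "\<forall>k<m. regular ((T ^^ k) p) \<and> regular ((T ^^ k) q) \<and> upper ((T ^^ k) p) = upper ((T ^^ k) q)"
    and "\<forall>k<m. \<bar>(T ^^ k) p $ j - (T ^^ k) q $ j\<bar> \<le> \<delta>"
  shows "\<bar>p $ i - q $ i\<bar> \<le> 2 * \<delta> + \<bar>(T ^^ m) p $ i - (T ^^ m) q $ i\<bar> / 4 ^ m"
  using assms(1,2,4,5)
proof (induction m arbitrary: p q)
  case (Suc m)
  have *: "\<forall>k<m. regular ((T ^^ k) (T p)) \<and> regular ((T ^^ k) (T q)) \<and> upper ((T ^^ k) (T p)) = upper ((T ^^ k) (T q))"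
    "\<forall>k<m. \<bar>(T ^^ k) (T p) $ j - (T ^^ k) (T q) $ j\<bar> \<le> \<delta>"
    using Suc.prems(3,4) by (auto simp flip: funpow_Suc_right o_apply[of "T ^^ _" T])
  have 0: "regular p" "regular q" "upper p = upper q" "\<bar>p $ j - q $ j\<bar> \<le> \<delta>"
    using Suc.prems(3)[rule_format, of 0] Suc.prems(4)[rule_format, of 0] by auto
  \<comment> \<open>In the upper branch \<open>p $ i = p $ j - T p $ i / 4\<close>, so each step
    adds a height error. The constant 2 in the claim is stable because
    \<open>\<delta> + 2 * \<delta> / 4 \<le> 2 * \<delta>\<close>.\<close>
  have "\<bar>p $ i - q $ i\<bar> \<le> \<bar>p $ j - q $ j\<bar> + \<bar>T p $ i - T q $ i\<bar> / 4"
  proof (cases "upper p")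
    case True
    hence "T p $ i = 4 * (p $ j - p $ i)" "T q $ i = 4 * (q $ j - q $ i)"
      using T_upper(1) Suc.prems(1,2) 0 by auto
    hence "T p $ i - T q $ i = 4 * ((p $ j - q $ j) - (p $ i - q $ i))" by simp
    hence "\<bar>T p $ i - T q $ i\<bar> = 4 * \<bar>(p $ j - q $ j) - (p $ i - q $ i)\<bar>"
      by (simp only: abs_mult abs_numeral)
    moreover have "\<bar>p $ i - q $ i\<bar> \<le> \<bar>p $ j - q $ j\<bar> + \<bar>(p $ j - q $ j) - (p $ i - q $ i)\<bar>"
      by linarith
    ultimately show ?thesis by simp
  next
    case False
    hence "T p $ i = 4 * p $ i" "T q $ i = 4 * q $ i"
      using T_lower(1) Suc.prems(1,2) 0 by auto
    hence "T p $ i - T q $ i = 4 * (p $ i - q $ i)" by simp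
    hence "\<bar>T p $ i - T q $ i\<bar> = 4 * \<bar>p $ i - q $ i\<bar>"
      by (simp only: abs_mult abs_numeral)
    thus ?thesis by simp
  qed
  also have "\<bar>T p $ i - T q $ i\<bar> \<le> 2 * \<delta> + \<bar>(T ^^ m) (T p) $ i - (T ^^ m) (T q) $ i\<bar> / 4 ^ m"
    using Suc.IH[OF _ _ *] Suc.prems T_in_cube by auto
  also have "(T ^^ m) (T p) = (T ^^ Suc m) p" by (simp add: funpow_swap1)
  also have "(T ^^ m) (T q) = (T ^^ Suc m) q" by (simp add: funpow_swap1)
  finally have "\<bar>p $ i - q $ i\<bar> \<le> \<bar>p $ j - q $ j\<bar> + (2 * \<delta> + \<bar>(T ^^ Suc m) p $ i - (T ^^ Suc m) q $ i\<bar> / 4 ^ m) / 4"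
    by simp
  also have "\<dots> = \<bar>p $ j - q $ j\<bar> + \<delta> / 2 + \<bar>(T ^^ Suc m) p $ i - (T ^^ Suc m) q $ i\<bar> / 4 ^ Suc m"
    by (simp add: add_divide_distrib)
  finally show ?case using 0(4) assms(3) by linarith
qed (use assms(3) in auto)

section \<open>Discretized heights\<close>

definition height_cell :: "nat \<Rightarrow> real ^ 'n \<Rightarrow> nat" where
  "height_cell J p = nat \<lfloor>J * p $ j\<rfloor>"

lemma height_cell_le: "p \<in> unit_cube \<Longrightarrow> height_cell J p \<le> J"
  using cubeD[of p j] mult_left_mono[of "p $ j" 1 "real J"] unfolding height_cell_def by linarith

end

lemma nat_floor_eq_imp_close:
  fixes x y :: real
  assumes "nat \<lfloor>real J * x\<rfloor> = nat \<lfloor>real J * y\<rfloor>" "0 \<le> x" "0 \<le> y" "J > 0"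
  shows "\<bar>x - y\<bar> \<le> 1 / J"
proof -
  have "\<lfloor>real J * x\<rfloor> \<ge> 0" "\<lfloor>real J * y\<rfloor> \<ge> 0" using assms by auto
  hence "\<lfloor>real J * x\<rfloor> = \<lfloor>real J * y\<rfloor>" using assms(1) by linarith
  hence "\<bar>real J * x - real J * y\<bar> \<le> 1" by linarith
  moreover have "real J * x - real J * y = real J * (x - y)" by (simp add: right_diff_distrib)
  ultimately have "real J * \<bar>x - y\<bar> \<le> 1" by (simp add: abs_mult)
  thus ?thesis using assms(4) by (simp add: field_simps)
qed

context cone_map begin

lemma height_cell_close:
  assumes "height_cell J p = height_cell J q" "p \<in> unit_cube" "q \<in> unit_cube" "J > 0"
  shows "\<bar>p $ j - q $ j\<bar> \<le> 1 / J"
  using assms cubeD by (intro nat_floor_eq_imp_close) (auto simp: height_cell_def)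

text \<open>Given the symbols, all heights are monotone functions of the initial height, so the sum of
  the cell indices determines each of them.\<close>
lemma height_cells_determined:
  assumes "p \<in> unit_cube" "q \<in> unit_cube" "A \<subseteq> {..m}"
    and same: "\<forall>k<m. regular ((T ^^ k) p) \<and> regular ((T ^^ k) q) \<and> upper ((T ^^ k) p) = upper ((T ^^ k) q)"
    and sum: "(\<Sum>k\<in>A. height_cell J ((T ^^ k) p)) = (\<Sum>k\<in>A. height_cell J ((T ^^ k) q))"
    and "k \<in> A"
  shows "height_cell J ((T ^^ k) p) = height_cell J ((T ^^ k) q)"
proof -
  \<comment> \<open>By symmetry let \<open>p\<close> start no higher than \<open>q\<close>. Then all
    indices are ordered the same way, and equal sums force equality term by term. Time
    \<open>m\<close> itself is allowed in \<open>A\<close>, since its height depends only on the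
    symbols before \<open>m\<close>.\<close>
  have main: "height_cell J ((T ^^ k) p) = height_cell J ((T ^^ k) q)"
    if pq: "p \<in> unit_cube" "q \<in> unit_cube" "p $ j \<le> q $ j"
      and same: "\<forall>k<m. regular ((T ^^ k) p) \<and> regular ((T ^^ k) q) \<and> upper ((T ^^ k) p) = upper ((T ^^ k) q)"
      and sum: "(\<Sum>k\<in>A. height_cell J ((T ^^ k) p)) = (\<Sum>k\<in>A. height_cell J ((T ^^ k) q))" for p q
  proof (rule sum_mono_inv[OF sum])
    fix l assume "l \<in> A"
    hence l: "l \<le> m" using assms(3) by auto
    have "(T ^^ l) p $ j \<le> (T ^^ l) q $ j"
      by (rule height_mono) (use pq same l in auto)
    thus "height_cell J ((T ^^ l) p) \<le> height_cell J ((T ^^ l) q)"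
      unfolding height_cell_def by (intro nat_mono floor_mono mult_left_mono) auto
  qed (use assms(3,6) finite_subset in auto)
  show ?thesis
  proof (cases "p $ j \<le> q $ j")
    case True
    thus ?thesis using main assms by blast
  next
    case False
    thus ?thesis using main[of q p] assms by (metis linear)
  qed
qed

end

lemma invariant_system_of_invariant_measure:
  "M \<in> invariant_measures T X \<Longrightarrow> invariant_system M T"
  by (simp add: invariant_measures_def invariant_system_def invariant_system_axioms_def)

lemma space_invariant_measure: "M \<in> invariant_measures T X \<Longrightarrow> space M = X"
  using sets_eq_imp_space_eq[of M "restrict_space borel X"]
  by (auto simp: invariant_measures_def space_restrict_space)

lemma Collect_in_sets_restrict_space:
  assumes "{x. P x} \<in> sets N"
  shows "{x \<in> X. P x} \<in> sets (restrict_space N X)"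
proof -
  have "{x \<in> X. P x} = X \<inter> {x. P x}" by auto
  thus ?thesis using assms unfolding sets_restrict_space by blast
qed

context cone_map begin

lemma measurable_T:
  "T \<in> restrict_space borel unit_cube \<rightarrow>\<^sub>M restrict_space borel unit_cube"
proof (rule measurable_restrict_space2)
  show "T \<in> space (restrict_space borel unit_cube) \<rightarrow> unit_cube"
    using T_in_cube by (auto simp: space_restrict_space simp del: mem_box_cart)
  show "T \<in> restrict_space borel unit_cube \<rightarrow>\<^sub>M borel"
    by (intro measurable_restrict_space1 borel_measurable_continuous_onI continuous_T)
qed

lemma measurable_upper: "{p \<in> unit_cube. upper p} \<in> sets (restrict_space borel unit_cube)"
proof -
  have "{p :: real ^ 'n. upper p} \<in> sets borel" unfolding upper_def by measurable
  thus ?thesis by (rule Collect_in_sets_restrict_space)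
qed

lemma measurable_regular: "{p \<in> unit_cube. regular p} \<in> sets (restrict_space borel unit_cube)"
proof -
  have "{p :: real ^ 'n. regular p} \<in> sets borel"
    unfolding regular_def upper_def if_bool_eq_disj by measurable
  thus ?thesis by (rule Collect_in_sets_restrict_space)
qed

lemma measurable_height: "{p \<in> unit_cube. c \<le> p $ j} \<in> sets (restrict_space borel unit_cube)"
proof -
  have "{p :: real ^ 'n. c \<le> p $ j} \<in> sets borel" by measurable
  thus ?thesis by (rule Collect_in_sets_restrict_space)
qed

lemma measurable_plane:
  "{p \<in> unit_cube. \<forall>k. k \<noteq> i \<longrightarrow> k \<noteq> j \<longrightarrow> p $ k = 0} \<in> sets (restrict_space borel unit_cube)"
proof -
  have "{p :: real ^ 'n. \<forall>k. k \<noteq> i \<longrightarrow> k \<noteq> j \<longrightarrow> p $ k = 0} = (\<Inter>k\<in>-{i, j}. {p. p $ k = 0}) " by auto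
  moreover have "closed (\<Inter>k\<in>-{i, j}. {p :: real ^ 'n. p $ k = 0})"
    by (intro closed_INT ballI closed_Collect_eq continuous_intros)
  ultimately have "{p :: real ^ 'n. \<forall>k. k \<noteq> i \<longrightarrow> k \<noteq> j \<longrightarrow> p $ k = 0} \<in> sets borel"
    by (simp add: borel_closed)
  thus ?thesis by (rule Collect_in_sets_restrict_space)
qed

lemma measurable_height_cell:
  "{p \<in> unit_cube. height_cell J p = y} \<in> sets (restrict_space borel unit_cube)"
proof -
  have "{p :: real ^ 'n. nat \<lfloor>real J * p $ j\<rfloor> = y} \<in> sets borel" by measurable
  thus ?thesis unfolding height_cell_def by (rule Collect_in_sets_restrict_space)
qed

end

section \<open>Upper bound for the topological entropy\<close>

text \<open>One representative from each code class already spans.\<close>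

lemma spanning_set_of_code:
  fixes T :: "'a::metric_space \<Rightarrow> 'a"
  assumes "finite S" "code ` X \<subseteq> S"
    and close: "\<And>x y k. x \<in> X \<Longrightarrow> y \<in> X \<Longrightarrow> code x = code y \<Longrightarrow> k < n \<Longrightarrow> dist ((T ^^ k) x) ((T ^^ k) y) < \<epsilon>"
  shows "\<exists>E. spanning_set T X n \<epsilon> E \<and> card E \<le> card S"
proof -
  define E where "E = inv_into X code ` (code ` X)"
  have fin: "finite (code ` X)" using assms(1,2) finite_subset by blast
  have "X \<subseteq> (\<Union>x\<in>E. bowen_ball T n \<epsilon> x)"
  proof
    fix y assume y: "y \<in> X"
    define x where "x = inv_into X code (code y)"
    have "x \<in> X" "code x = code y"
      using y unfolding x_def by (auto intro: inv_into_into f_inv_into_f)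
    hence "y \<in> bowen_ball T n \<epsilon> x" using close y by (auto simp: bowen_ball_def)
    moreover have "x \<in> E" using y by (auto simp: E_def x_def)
    ultimately show "y \<in> (\<Union>x\<in>E. bowen_ball T n \<epsilon> x)" by blast
  qed
  moreover have "E \<subseteq> X" unfolding E_def by (auto intro: inv_into_into)
  moreover have "card E \<le> card S"
    unfolding E_def using card_image_le[OF fin] card_mono[OF assms(1,2)] le_trans by blast
  ultimately show ?thesis using fin unfolding spanning_set_def E_def by blast
qed

lemma topological_entropy_le:
  assumes "X \<noteq> {}"
    and "\<And>\<epsilon>. \<epsilon> > 0 \<Longrightarrow> \<exists>f. (\<lambda>n. f n / real n) \<longlonglongrightarrow> l \<and>
       (\<forall>n>0. \<exists>E. spanning_set T X n \<epsilon> E \<and> ln (real (card E)) \<le> f n)"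
  shows "topological_entropy T X \<le> ereal l"
  unfolding topological_entropy_def
proof (rule SUP_least)
  fix \<epsilon> :: real assume "\<epsilon> \<in> {0<..}"
  then obtain f where f: "(\<lambda>n. f n / real n) \<longlonglongrightarrow> l"
    "\<And>n. n > 0 \<Longrightarrow> \<exists>E. spanning_set T X n \<epsilon> E \<and> ln (real (card E)) \<le> f n"
    using assms(2)[of \<epsilon>] by auto
  have "limsup (\<lambda>n. INF E\<in>{E. spanning_set T X n \<epsilon> E}. ereal (ln (real (card E)) / real n))
      \<le> limsup (\<lambda>n. ereal (f n / real n))"
  proof (rule Limsup_mono, rule eventually_mono[OF eventually_gt_at_top[of 0]])
    fix n :: nat assume n: "n > 0"
    then obtain E where E: "spanning_set T X n \<epsilon> E" "ln (real (card E)) \<le> f n" using f(2) by blast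
    show "(INF E\<in>{E. spanning_set T X n \<epsilon> E}. ereal (ln (real (card E)) / real n)) \<le> ereal (f n / real n)"
      by (rule INF_lower2[of E]) (use E n in \<open>auto intro: divide_right_mono\<close>)
  qed
  also have "\<dots> = ereal l"
    using f(1) by (intro lim_imp_Limsup) auto
  finally show "limsup (\<lambda>n. INF E\<in>{E. spanning_set T X n \<epsilon> E}. ereal (ln (real (card E)) / real n)) \<le> ereal l" .
qed

context cone_map begin

text \<open>\<open>min\<close> and \<open>max\<close> do not increase errors; the factor 8 comes
  from \<open>4 * (p $ j - p $ i)\<close>, where the errors of both coordinates add.\<close>

lemma T_Lipschitz:
  assumes "\<bar>p $ i - q $ i\<bar> \<le> \<delta>" "\<bar>p $ j - q $ j\<bar> \<le> \<delta>"
  shows "\<bar>T p $ i - T q $ i\<bar> \<le> 8 * \<delta>" "\<bar>T p $ j - T q $ j\<bar> \<le> 8 * \<delta>"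
proof -
  have mx: "\<bar>max a b - max c d\<bar> \<le> e" if "\<bar>a - c\<bar> \<le> e" "\<bar>b - d\<bar> \<le> e" for a b c d e :: real
    using that by (auto simp: max_def abs_le_iff)
  have mn: "\<bar>min a b - min c d\<bar> \<le> e" if "\<bar>a - c\<bar> \<le> e" "\<bar>b - d\<bar> \<le> e" for a b c d e :: real
    using that by (auto simp: min_def abs_le_iff)
  have d: "\<delta> \<ge> 0" using assms(1) by linarith
  have "\<bar>min (p $ i) (p $ j - p $ i) - min (q $ i) (q $ j - q $ i)\<bar> \<le> 2 * \<delta>"
    by (rule mn) (use assms d in linarith)+
  moreover have "\<bar>4 * x - 4 * y\<bar> \<le> 8 * \<delta>" if "\<bar>x - y\<bar> \<le> 2 * \<delta>" for x y :: real
    using that by linarith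
  ultimately have "\<bar>4 * min (p $ i) (p $ j - p $ i) - 4 * min (q $ i) (q $ j - q $ i)\<bar> \<le> 8 * \<delta>"
    by blast
  thus "\<bar>T p $ i - T q $ i\<bar> \<le> 8 * \<delta>" unfolding T_i by (intro mx mn) (use d in auto)
  show "\<bar>T p $ j - T q $ j\<bar> \<le> 8 * \<delta>" unfolding T_j
    by (intro mx mn) (use assms d in linarith)+
qed

text \<open>The cap makes the minimum exist: the value is \<open>n\<close> exactly when the orbit is
  regular at all times below \<open>n\<close>.\<close>

definition exit_time :: "nat \<Rightarrow> real ^ 'n \<Rightarrow> nat" where
  "exit_time n p = (LEAST m. m = n \<or> \<not> regular ((T ^^ m) p))"

lemma exit_time:
  "exit_time n p \<le> n" "exit_time n p < n \<Longrightarrow> \<not> regular ((T ^^ exit_time n p) p)"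
  "k < exit_time n p \<Longrightarrow> regular ((T ^^ k) p)"
proof -
  let ?P = "\<lambda>m. m = n \<or> \<not> regular ((T ^^ m) p)"
  show "exit_time n p \<le> n" unfolding exit_time_def by (rule Least_le) simp
  have "?P (exit_time n p)" unfolding exit_time_def by (rule LeastI[of ?P n]) simp
  thus "exit_time n p < n \<Longrightarrow> \<not> regular ((T ^^ exit_time n p) p)" by auto
  show "k < exit_time n p \<Longrightarrow> regular ((T ^^ k) p)"
    unfolding exit_time_def using not_less_Least[of k ?P] by blast
qed

text \<open>Once an orbit has left the regular region it lands on the contracted axis within two steps.\<close>
lemma orbit_coords_close:
  assumes p: "p \<in> unit_cube" and q: "q \<in> unit_cube" and J: "J > 0"
    and m: "exit_time n p = m" "exit_time n q = m"
    and up: "\<forall>k<m. upper ((T ^^ k) p) = upper ((T ^^ k) q)"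
    and sum: "(\<Sum>k\<le>m. height_cell J ((T ^^ k) p)) = (\<Sum>k\<le>m. height_cell J ((T ^^ k) q))"
    and ex: "nat \<lfloor>real J * (T ^^ m) p $ i\<rfloor> = nat \<lfloor>real J * (T ^^ m) q $ i\<rfloor>"
    and k: "k \<le> n"
  shows "\<bar>(T ^^ k) p $ i - (T ^^ k) q $ i\<bar> \<le> 64 / J \<and> \<bar>(T ^^ k) p $ j - (T ^^ k) q $ j\<bar> \<le> 64 / J"
proof -
  have same: "\<forall>k<m. regular ((T ^^ k) p) \<and> regular ((T ^^ k) q) \<and> upper ((T ^^ k) p) = upper ((T ^^ k) q)"
    using exit_time(3)[of _ n p] exit_time(3)[of _ n q] m up by auto
  have fa: "(T ^^ a) ((T ^^ b) x) = (T ^^ (a + b)) x" for a b x by (simp add: funpow_add)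
  note cube = funpow_T_in_cube[OF p] funpow_T_in_cube[OF q]
  have hj: "\<bar>(T ^^ k) p $ j - (T ^^ k) q $ j\<bar> \<le> 1 / J" if "k \<le> m" for k
    using height_cells_determined[OF p q _ same sum] that cube J
    by (intro height_cell_close) auto
  have im: "\<bar>(T ^^ m) p $ i - (T ^^ m) q $ i\<bar> \<le> 1 / J"
    by (rule nat_floor_eq_imp_close[OF ex]) (use cube cubeD J in auto)
  \<comment> \<open>Up to the exit time, contraction works backwards from it. The next step costs a
    factor 8, the one after another 8, which explains 64; from then on both orbits lie on the axis,
    where height differences halve.\<close>
  consider "k \<le> m" | "k = m + 1" | "k \<ge> m + 2" by linarith
  thus ?thesis
  proof cases
    case 1
    have "\<bar>(T ^^ k) p $ i - (T ^^ k) q $ i\<bar>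
        \<le> 2 * (1 / J) + \<bar>(T ^^ (m - k)) ((T ^^ k) p) $ i - (T ^^ (m - k)) ((T ^^ k) q) $ i\<bar> / 4 ^ (m - k)"
    proof (rule position_contraction)
      show "\<forall>l<m - k. regular ((T ^^ l) ((T ^^ k) p)) \<and> regular ((T ^^ l) ((T ^^ k) q))
          \<and> upper ((T ^^ l) ((T ^^ k) p)) = upper ((T ^^ l) ((T ^^ k) q))"
        using same by (simp add: fa)
      show "\<forall>l<m - k. \<bar>(T ^^ l) ((T ^^ k) p) $ j - (T ^^ l) ((T ^^ k) q) $ j\<bar> \<le> 1 / J"
        using hj 1 by (simp add: fa)
    qed (use cube in auto)
    also have "(T ^^ (m - k)) ((T ^^ k) p) = (T ^^ m) p"
      using 1 by (simp add: fa)
    also have "(T ^^ (m - k)) ((T ^^ k) q) = (T ^^ m) q"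
      using 1 by (simp add: fa)
    also have "\<bar>(T ^^ m) p $ i - (T ^^ m) q $ i\<bar> / 4 ^ (m - k) \<le> \<bar>(T ^^ m) p $ i - (T ^^ m) q $ i\<bar> / 1"
      by (intro divide_left_mono) auto
    finally have "\<bar>(T ^^ k) p $ i - (T ^^ k) q $ i\<bar> \<le> 3 / J" using im by (simp add: field_simps)
    moreover have "3 / J \<le> 64 / J" "1 / J \<le> 64 / J" by (auto intro: divide_right_mono)
    ultimately show ?thesis using hj[OF 1] by linarith
  next
    case 2
    have "8 * (1 / J) \<le> 64 / J" using J by (simp add: divide_right_mono)
    thus ?thesis using T_Lipschitz[OF im hj[OF order_refl]] 2 by auto
  next
    case 3
    have "m < n" using 3 k by simp
    hence irr: "\<not> regular ((T ^^ m) p)" "\<not> regular ((T ^^ m) q)"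
      using exit_time(2)[of n p] exit_time(2)[of n q] m by auto
    obtain l where l: "k = l + 2 + m" using 3 by (metis add.assoc add.commute le_Suc_ex)
    have k_eq: "(T ^^ k) x = (T ^^ l) (T (T ((T ^^ m) x)))" for x
      unfolding l funpow_add by (simp add: numeral_2_eq_2)
    have "\<bar>T (T ((T ^^ m) p)) $ j - T (T ((T ^^ m) q)) $ j\<bar> \<le> 8 * (8 * (1 / J))"
      using T_Lipschitz[OF T_Lipschitz[OF im hj[OF order_refl]]] by simp
    hence "\<bar>T (T ((T ^^ m) p)) $ j - T (T ((T ^^ m) q)) $ j\<bar> / 2 ^ l \<le> 64 / J / 1"
      by (intro frac_le) auto
    moreover have "(T ^^ k) x $ i = 0 \<and> (T ^^ k) x $ j = T (T ((T ^^ m) x)) $ j / 2 ^ l"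
      if "x \<in> unit_cube" "\<not> regular ((T ^^ m) x)" for x
      unfolding k_eq
      by (rule funpow_T_axis) (use that T_irregular T_in_cube funpow_T_in_cube in auto)
    ultimately show ?thesis using p q irr J by (simp flip: diff_divide_distrib)
  qed
qed

text \<open>An orbit of length \<open>n\<close> is known up to \<open>\<epsilon>\<close> from its
  coin word together with its exit time, the sum of the height indices up to that time, the position
  cell at the exit and a ball containing the initial point. Apart from the word, this leaves only
  polynomially many possibilities in \<open>n\<close>.\<close>

lemma topological_entropy_T_le: "topological_entropy T unit_cube \<le> ereal (ln 2)"
proof (rule topological_entropy_le)
  show "(unit_cube :: (real ^ 'n) set) \<noteq> {}"
    using mem_unit_cube[of "0 :: real ^ 'n"] by auto
next
  fix \<epsilon> :: real assume \<epsilon>: "\<epsilon> > 0"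
  \<comment> \<open>The errors \<open>64 / J\<close> of the two active coordinates add up to
    \<open>128 / J\<close>.\<close>
  obtain J :: nat where J: "real J > 128 / \<epsilon>" using reals_Archimedean2 by blast
  have J0: "J > 0" using J \<epsilon> by (metis divide_pos_pos less_trans of_nat_0_less_iff zero_less_numeral)
  have J\<epsilon>: "128 / J < \<epsilon>" using J J0 \<epsilon> by (simp add: field_simps)
  \<comment> \<open>The other coordinates vanish after one step, so they matter only at time 0; a
    finite net of balls of radius \<open>\<epsilon> / 2\<close> takes care of them.\<close>
  have "\<forall>e>0. \<exists>C. finite C \<and> (unit_cube :: (real ^ 'n) set) \<subseteq> (\<Union>c\<in>C. ball c e)"
    using compact_cbox[of "0 :: real ^ 'n" 1] unfolding compact_eq_totally_bounded by blast
  then obtain C where C: "finite C" "(unit_cube :: (real ^ 'n) set) \<subseteq> (\<Union>c\<in>C. ball c (\<epsilon> / 2))"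
    using half_gt_zero[OF \<epsilon>] by blast
  define center where "center p = (SOME c. c \<in> C \<and> p \<in> ball c (\<epsilon> / 2))" for p :: "real ^ 'n"
  have center: "center p \<in> C" "p \<in> ball (center p) (\<epsilon> / 2)" if "p \<in> unit_cube" for p
  proof -
    have "\<exists>c. c \<in> C \<and> p \<in> ball c (\<epsilon> / 2)" using C(2) that by blast
    from someI_ex[OF this] show "center p \<in> C" "p \<in> ball (center p) (\<epsilon> / 2)"
      by (simp_all add: center_def)
  qed
  define c where "c = real (card C)"
  have "C \<noteq> {}" using center(1)[of 0] by (auto simp: mem_unit_cube)
  hence c: "c > 0" unfolding c_def using C(1) by (simp add: card_gt_0_iff)
  define f where "f n = ln (2 ^ n * (real n + 1) * (real J * (real n + 1) + 1) * (real J + 1) * c)" for n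
  have "real J * (real n + 1) + 1 \<noteq> 0" for n
    using add_nonneg_pos[of "real J * (real n + 1)" 1] by simp
  hence "f = (\<lambda>n. n * ln 2 + ln (real n + 1) + ln (real J * (real n + 1) + 1) + ln (real J + 1) + ln c)"
    using c by (simp add: fun_eq_iff f_def ln_mult ln_realpow add_nonneg_pos add_pos_pos)
  moreover have "(\<lambda>n. (n * ln 2 + ln (real n + 1) + ln (real J * (real n + 1) + 1) + ln (real J + 1) + ln c) / real n) \<longlonglongrightarrow> ln 2"
    using J0 c by real_asymp
  ultimately have "(\<lambda>n. f n / real n) \<longlonglongrightarrow> ln 2" by simp
  moreover have "\<exists>E. spanning_set T unit_cube n \<epsilon> E \<and> ln (real (card E)) \<le> f n" if n: "n > 0" for n
  proof -
    define code where "code p = (map (\<lambda>k. upper ((T ^^ k) p)) [0..<n], exit_time n p,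
      \<Sum>k\<le>exit_time n p. height_cell J ((T ^^ k) p), nat \<lfloor>real J * (T ^^ exit_time n p) p $ i\<rfloor>, center p)" for p
    define S where "S = {w::bool list. length w = n} \<times> {..n} \<times> {..J * (n + 1)} \<times> {..J} \<times> C"
    have words: "finite {w::bool list. length w = n}" "card {w::bool list. length w = n} = 2 ^ n"
      using finite_lists_length_eq[of "UNIV :: bool set" n] card_lists_length_eq[of "UNIV :: bool set" n]
      by (auto simp: card_UNIV_bool)
    have "finite S" unfolding S_def using words C by auto
    have cardS: "real (card S) = 2 ^ n * (real n + 1) * (real J * (real n + 1) + 1) * (real J + 1) * c"
      unfolding S_def card_cartesian_product words c_def by (simp add: algebra_simps)
    have code_S: "code ` unit_cube \<subseteq> S"
    proof (rule image_subsetI)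
      fix p :: "real ^ 'n" assume p: "p \<in> unit_cube"
      have "(\<Sum>k\<le>exit_time n p. height_cell J ((T ^^ k) p)) \<le> (\<Sum>k\<le>exit_time n p. J)"
        using height_cell_le funpow_T_in_cube[OF p] by (intro sum_mono) auto
      also have "\<dots> \<le> J * (n + 1)" using exit_time(1)[of n p] by simp
      finally have 1: "(\<Sum>k\<le>exit_time n p. height_cell J ((T ^^ k) p)) \<le> J * (n + 1)" .
      have "real J * (T ^^ exit_time n p) p $ i \<le> real J * 1"
        using cubeD funpow_T_in_cube[OF p] by (intro mult_left_mono) auto
      hence 2: "nat \<lfloor>real J * (T ^^ exit_time n p) p $ i\<rfloor> \<le> J" by linarith
      show "code p \<in> S" using 1 2 exit_time(1) center(1)[OF p] by (auto simp: code_def S_def)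
    qed
    have "\<exists>E. spanning_set T unit_cube n \<epsilon> E \<and> card E \<le> card S"
    proof (rule spanning_set_of_code[OF \<open>finite S\<close> code_S])
      fix p q k assume p: "p \<in> unit_cube" and q: "q \<in> unit_cube" and eq: "code p = code q" and k: "k < n"
      define m where "m = exit_time n p"
      have m: "exit_time n p = m" "exit_time n q = m" using eq by (auto simp: code_def m_def)
      have "\<bar>(T ^^ k) p $ i - (T ^^ k) q $ i\<bar> \<le> 64 / J \<and> \<bar>(T ^^ k) p $ j - (T ^^ k) q $ j\<bar> \<le> 64 / J"
        by (rule orbit_coords_close[OF p q J0 m])
          (use eq k m exit_time(1)[of n p] in \<open>auto simp: code_def\<close>)
      hence *: "\<bar>(T ^^ k) p $ i - (T ^^ k) q $ i\<bar> + \<bar>(T ^^ k) p $ j - (T ^^ k) q $ j\<bar> < \<epsilon>"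
        using J\<epsilon> by linarith
      show "dist ((T ^^ k) p) ((T ^^ k) q) < \<epsilon>"
      proof (cases k)
        case 0
        have "p \<in> ball (center p) (\<epsilon> / 2)" "q \<in> ball (center p) (\<epsilon> / 2)"
          using center(2)[OF p] center(2)[OF q] eq by (auto simp: code_def)
        thus ?thesis using 0 dist_triangle_half_r[of "center p" p \<epsilon> q] by auto
      next
        case (Suc l)
        show ?thesis
          by (rule le_less_trans[OF dist_le_coords *]) (simp add: Suc T_other)
      qed
    qed
    then obtain E where E: "spanning_set T unit_cube n \<epsilon> E" "card E \<le> card S" by blast
    have "0 \<in> (unit_cube :: (real ^ 'n) set)" by (auto simp: mem_unit_cube)
    hence "E \<noteq> {}" using E(1) unfolding spanning_set_def by fastforce
    hence "card E > 0" using E(1) by (simp add: spanning_set_def card_gt_0_iff)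
    hence "ln (real (card E)) \<le> ln (real (card S))" using E(2) by simp
    thus ?thesis using E(1) by (auto simp: cardS f_def)
  qed
  ultimately show "\<exists>f. (\<lambda>n. f n / real n) \<longlonglongrightarrow> ln 2 \<and>
       (\<forall>n>0. \<exists>E. spanning_set T unit_cube n \<epsilon> E \<and> ln (real (card E)) \<le> f n)" by blast
qed

end

section \<open>Lower bound for the topological entropy\<close>

text \<open>Two points in one Bowen ball stay closer than \<open>2 * \<epsilon>\<close> at all times
  below \<open>n\<close>, so each ball holds at most one point of \<open>S\<close>.\<close>

lemma card_le_of_separated:
  assumes "S \<subseteq> X" and E: "spanning_set T X n \<epsilon> E"
    and sep: "\<And>x y. x \<in> S \<Longrightarrow> y \<in> S \<Longrightarrow> x \<noteq> y \<Longrightarrow> \<exists>k<n. 2 * \<epsilon> \<le> dist ((T ^^ k) x) ((T ^^ k) y)"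
  shows "card S \<le> card E"
proof -
  define c where "c x = (SOME e. e \<in> E \<and> x \<in> bowen_ball T n \<epsilon> e)" for x
  have c: "c x \<in> E" "x \<in> bowen_ball T n \<epsilon> (c x)" if "x \<in> S" for x
  proof -
    have "\<exists>e. e \<in> E \<and> x \<in> bowen_ball T n \<epsilon> e"
      using that assms(1) E unfolding spanning_set_def by blast
    from someI_ex[OF this] show "c x \<in> E" "x \<in> bowen_ball T n \<epsilon> (c x)" by (simp_all add: c_def)
  qed
  have "inj_on c S"
  proof (rule inj_onI, rule ccontr)
    fix x y assume xy: "x \<in> S" "y \<in> S" "c x = c y" "x \<noteq> y"
    then obtain k where k: "k < n" "2 * \<epsilon> \<le> dist ((T ^^ k) x) ((T ^^ k) y)" using sep by blast
    have "dist ((T ^^ k) (c x)) ((T ^^ k) x) < \<epsilon>" "dist ((T ^^ k) (c x)) ((T ^^ k) y) < \<epsilon>"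
      using c(2)[OF xy(1)] c(2)[OF xy(2)] xy(3) k(1) by (auto simp: bowen_ball_def)
    hence "dist ((T ^^ k) x) ((T ^^ k) y) < 2 * \<epsilon>"
      using dist_triangle3[of "(T ^^ k) x" "(T ^^ k) y" "(T ^^ k) (c x)"] by linarith
    thus False using k(2) by linarith
  qed
  moreover have "c ` S \<subseteq> E" using c(1) by auto
  moreover have "finite E" using E by (simp add: spanning_set_def)
  ultimately show ?thesis by (metis card_inj_on_le)
qed

lemma topological_entropy_ge:
  fixes c r \<epsilon> :: real
  assumes "\<epsilon> > 0" "c > 0" "r > 0"
    and "\<And>n. n > 0 \<Longrightarrow> \<exists>S\<subseteq>X. c * r ^ n \<le> card S \<and>
      (\<forall>x\<in>S. \<forall>y\<in>S. x \<noteq> y \<longrightarrow> (\<exists>k<n. 2 * \<epsilon> \<le> dist ((T ^^ k) x) ((T ^^ k) y)))"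
  shows "ereal (ln r) \<le> topological_entropy T X"
proof -
  have "(\<lambda>n. ln (c * r ^ n) / real n) \<longlonglongrightarrow> ln r"
  proof -
    have "(\<lambda>n. ln c / real n + ln r) \<longlonglongrightarrow> 0 + ln r"
      by (intro tendsto_intros lim_const_over_n)
    moreover have "\<forall>\<^sub>F n in sequentially. ln c / real n + ln r = ln (c * r ^ n) / real n"
      using eventually_gt_at_top[of 0]
      by eventually_elim (use assms(2,3) in \<open>simp add: ln_mult ln_realpow field_simps\<close>)
    ultimately show ?thesis using tendsto_cong by fastforce
  qed
  hence "ereal (ln r) = limsup (\<lambda>n. ereal (ln (c * r ^ n) / real n))"
    by (intro lim_imp_Limsup[symmetric]) auto
  also have "\<dots> \<le> limsup (\<lambda>n. INF E\<in>{E. spanning_set T X n \<epsilon> E}. ereal (ln (real (card E)) / real n))"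
  proof (rule Limsup_mono, rule eventually_mono[OF eventually_gt_at_top[of 0]], rule INF_greatest)
    fix n :: nat and E assume n: "n > 0" and E: "E \<in> {E. spanning_set T X n \<epsilon> E}"
    obtain S where S: "S \<subseteq> X" "c * r ^ n \<le> card S"
      "\<forall>x\<in>S. \<forall>y\<in>S. x \<noteq> y \<longrightarrow> (\<exists>k<n. 2 * \<epsilon> \<le> dist ((T ^^ k) x) ((T ^^ k) y))"
      using assms(4)[OF n] by blast
    have "card S \<le> card E" by (rule card_le_of_separated[OF S(1)]) (use E S(3) in auto)
    hence "c * r ^ n \<le> card E" using S(2) by linarith
    moreover have "c * r ^ n > 0" using assms by simp
    ultimately have "ln (c * r ^ n) \<le> ln (card E)" by simp
    thus "ereal (ln (c * r ^ n) / real n) \<le> ereal (ln (real (card E)) / real n)"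
      by (simp add: divide_right_mono)
  qed
  also have "\<dots> \<le> topological_entropy T X"
    unfolding topological_entropy_def by (rule SUP_upper) (use assms(1) in auto)
  finally show ?thesis .
qed

text \<open>Level \<open>l\<close> stands for the height \<open>(1/2) ^ l\<close>, so the symbol \<open>True\<close>, which doubles the height, lowers the level.\<close>
fun walks :: "nat \<Rightarrow> nat \<Rightarrow> nat \<Rightarrow> bool list set" where
  "walks K 0 l = {[]}"
| "walks K (Suc n) l =
     (if 0 < l \<and> l < K then Cons True ` walks K n (l - 1) \<union> Cons False ` walks K n (l + 1) else {})"

lemma finite_walks [simp]: "finite (walks K n l)"
  by (induction K n l rule: walks.induct) auto

text \<open>The sine is the Perron eigenvector of the walk killed at \<open>0\<close> and \<open>K\<close>.\<close>
lemma card_walks_ge: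
  assumes "K \<ge> 2" "l \<le> K"
  shows "(2 * cos (pi / K)) ^ n * sin (l * (pi / K)) \<le> card (walks K n l)"
  using assms(2)
proof (induction n arbitrary: l)
  case (Suc n)
  define \<theta> where "\<theta> = pi / K"
  show ?case
  proof (cases "0 < l \<and> l < K")
    case True
    have "2 * cos \<theta> * sin (l * \<theta>) = sin (real (l - 1) * \<theta>) + sin (real (l + 1) * \<theta>)"
      using True by (simp add: of_nat_diff algebra_simps sin_add sin_diff)
    moreover have "(2 * cos \<theta>) ^ Suc n * sin (l * \<theta>) = (2 * cos \<theta>) ^ n * (2 * cos \<theta> * sin (l * \<theta>))"
      by simp
    ultimately have "(2 * cos \<theta>) ^ Suc n * sin (l * \<theta>)
        = (2 * cos \<theta>) ^ n * sin (real (l - 1) * \<theta>) + (2 * cos \<theta>) ^ n * sin (real (l + 1) * \<theta>)"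
      by (simp only: distrib_left)
    also have "\<dots> \<le> card (walks K n (l - 1)) + card (walks K n (l + 1))"
      using Suc.IH[of "l - 1"] Suc.IH[of "l + 1"] True unfolding \<theta>_def by linarith
    also have "\<dots> = card (walks K (Suc n) l)"
      using True by (simp, subst card_Un_disjoint) (auto simp: card_image)
    finally show ?thesis by (simp add: \<theta>_def)
  next
    case False
    hence "l = 0 \<or> l = K" using Suc.prems by linarith
    hence "sin (l * (pi / K)) = 0" using assms(1) by auto
    thus ?thesis by simp
  qed
qed simp

text \<open>The inverse branches \<open>u = v - u' / 4\<close> and \<open>u = u' / 4\<close> are
  composed along the word, with the arbitrary terminal position 0. The result is the position at
  height \<open>(1/2) ^ l\<close> from which the orbit follows the word.\<close>

fun walk_pos :: "bool list \<Rightarrow> nat \<Rightarrow> real" where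
  "walk_pos [] l = 0"
| "walk_pos (True # w) l = (1/2) ^ l - walk_pos w (l - 1) / 4"
| "walk_pos (False # w) l = walk_pos w (l + 1) / 4"

lemma walk_pos_bounds: "w \<in> walks K n l \<Longrightarrow> 0 \<le> walk_pos w l \<and> walk_pos w l \<le> (1/2) ^ l"
proof (induction K n l arbitrary: w rule: walks.induct)
  case (2 K n l)
  then obtain b w' where w: "w = b # w'" "0 < l" "l < K" by (auto split: if_splits)
  have l: "(1/2::real) ^ (l - 1) = 2 * (1/2) ^ l" using w(2) by (cases l) auto
  have pos: "(1/2::real) ^ l > 0" by simp
  show ?case
  proof (cases b)
    case True
    hence "w' \<in> walks K n (l - 1)" using 2(3) w by auto
    hence "0 \<le> walk_pos w' (l - 1)" "walk_pos w' (l - 1) \<le> 2 * (1/2) ^ l"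
      using 2(1)[of w'] w l by auto
    thus ?thesis using w True pos by simp
  next
    case False
    hence "w' \<in> walks K n (l + 1)" using 2(3) w by auto
    hence "0 \<le> walk_pos w' (l + 1)" "walk_pos w' (l + 1) \<le> (1/2) ^ l / 2"
      using 2(2)[of w'] w by auto
    thus ?thesis using w False pos by simp
  qed
qed simp

context cone_map begin

definition plane_point :: "real \<Rightarrow> real \<Rightarrow> real ^ 'n" where
  "plane_point u v = (\<chi> k. if k = i then u else if k = j then v else 0)"

lemma plane_point_nth [simp]:
  "plane_point u v $ i = u" "plane_point u v $ j = v"
  using i_neq_j by (auto simp: plane_point_def)

lemma T_eq_plane_point: "T p = plane_point (T p $ i) (T p $ j)"
  by (auto simp: vec_eq_iff plane_point_def T_other)

lemma plane_point_in_cube: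
  "0 \<le> u \<Longrightarrow> u \<le> 1 \<Longrightarrow> 0 \<le> v \<Longrightarrow> v \<le> 1 \<Longrightarrow> plane_point u v \<in> unit_cube"
  by (auto simp: mem_unit_cube plane_point_def)

text \<open>The sector covers the full cone at the new height, including the case where that height
  is cut off. Together with the lower sector this makes every coin sequence realizable.\<close>

lemma T_plane_upper:
  assumes "0 \<le> u" "u \<le> min 1 (2 * v)" "0 \<le> v" "v \<le> 1"
  shows "T (plane_point (v - u / 4) v) = plane_point u (min 1 (2 * v))"
    "upper (plane_point (v - u / 4) v)"
proof -
  let ?p = "plane_point (v - u / 4) v"
  have c: "?p \<in> unit_cube" using assms by (intro plane_point_in_cube) auto
  show u: "upper ?p" using assms by (simp add: upper_def)
  have r: "regular ?p" using u assms by (simp add: regular_def)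
  show "T ?p = plane_point u (min 1 (2 * v))"
    by (subst T_eq_plane_point) (simp add: T_upper[OF c r u])
qed

text \<open>The height must be strictly positive here because the origin has the symbol
  \<open>upper\<close>.\<close>

lemma T_plane_lower:
  assumes "0 \<le> u" "u \<le> v / 2" "0 < v" "v \<le> 1"
  shows "T (plane_point (u / 4) v) = plane_point u (v / 2)"
    "\<not> upper (plane_point (u / 4) v)"
proof -
  let ?p = "plane_point (u / 4) v"
  have c: "?p \<in> unit_cube" using assms by (intro plane_point_in_cube) auto
  show u: "\<not> upper ?p" using assms by (simp add: upper_def)
  have r: "regular ?p" using u assms by (simp add: regular_def)
  show "T ?p = plane_point u (v / 2)"
    by (subst T_eq_plane_point) (simp add: T_lower[OF c r u])
qed

definition walk_point :: "bool list \<Rightarrow> nat \<Rightarrow> real ^ 'n" where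
  "walk_point w l = plane_point (walk_pos w l) ((1/2) ^ l)"

lemma T_walk_point:
  assumes "b # w \<in> walks K (Suc n) l"
  shows "T (walk_point (b # w) l) = walk_point w (if b then l - 1 else l + 1)"
proof -
  have l: "0 < l" "l < K" using assms by (auto split: if_splits)
  have l1: "(1/2::real) ^ (l - 1) = 2 * (1/2) ^ l" using l(1) by (cases l) auto
  have le1: "2 * (1/2::real) ^ l \<le> 1" unfolding l1[symmetric] by (simp add: power_le_one)
  show ?thesis
  proof (cases b)
    case True
    hence "w \<in> walks K n (l - 1)" using assms l by auto
    from walk_pos_bounds[OF this] show ?thesis
      using True l1 le1 T_plane_upper(1)[of "walk_pos w (l - 1)" "(1/2) ^ l"]
      by (simp add: walk_point_def)
  next
    case False
    hence "w \<in> walks K n (l + 1)" using assms l by auto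
    from walk_pos_bounds[OF this] show ?thesis
      using False le1 T_plane_lower(1)[of "walk_pos w (l + 1)" "(1/2) ^ l"]
      by (simp add: walk_point_def)
  qed
qed

text \<open>While the words agree, the heights agree too. At the first difference, with common
  height \<open>v\<close>, one position is at least \<open>v / 2\<close> and the other at most
  \<open>v / 8\<close>; the gap is \<open>3 / 8 * v\<close>, and \<open>v \<ge> (1/2) ^ K\<close>
  since the level is below \<open>K\<close>.\<close>

lemma walk_points_separated:
  assumes "w \<in> walks K n l" "w' \<in> walks K n l" "w \<noteq> w'"
  shows "\<exists>k<n. 3 / 8 * (1/2) ^ K \<le> dist ((T ^^ k) (walk_point w l)) ((T ^^ k) (walk_point w' l))"
  using assms
proof (induction n arbitrary: l w w')
  case (Suc n)
  from Suc.prems(1,2) obtain b x b' x' where w: "w = b # x" "w' = b' # x'" and l: "0 < l" "l < K"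
    by (auto split: if_splits)
  show ?case
  proof (cases "b = b'")
    case True
    define l' where "l' = (if b then l - 1 else l + 1)"
    have "x \<in> walks K n l'" "x' \<in> walks K n l'" "x \<noteq> x'"
      using Suc.prems w True l by (auto simp: l'_def split: if_splits)
    then obtain k where k: "k < n"
      "3 / 8 * (1/2) ^ K \<le> dist ((T ^^ k) (walk_point x l')) ((T ^^ k) (walk_point x' l'))"
      using Suc.IH by blast
    have "T (walk_point w l) = walk_point x l'" "T (walk_point w' l) = walk_point x' l'"
      using T_walk_point Suc.prems w True unfolding l'_def by blast+
    hence "(T ^^ Suc k) (walk_point w l) = (T ^^ k) (walk_point x l')"
      "(T ^^ Suc k) (walk_point w' l) = (T ^^ k) (walk_point x' l')"
      by (simp_all add: funpow_Suc_right del: funpow.simps)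
    thus ?thesis using k by (intro exI[of _ "Suc k"]) simp
  next
    case False
    have far: "3 / 8 * (1/2) ^ l \<le> \<bar>walk_pos (True # y) l - walk_pos (False # z) l\<bar>"
      if "True # y \<in> walks K (Suc n) l" "False # z \<in> walks K (Suc n) l" for y z
    proof -
      have "y \<in> walks K n (l - 1)" "z \<in> walks K n (l + 1)" using that l by auto
      from this[THEN walk_pos_bounds]
      have "3 / 8 * (1/2) ^ l \<le> walk_pos (True # y) l - walk_pos (False # z) l"
        using l(1) by (cases l) auto
      thus ?thesis by linarith
    qed
    have "3 / 8 * (1/2) ^ l \<le> \<bar>walk_pos w l - walk_pos w' l\<bar>"
    proof (cases b)
      case True
      hence "w = True # x" "w' = False # x'" using w False by auto
      with far[of x x'] Suc.prems(1,2) show ?thesis by (simp only:)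
    next
      case b: False
      hence "w = False # x" "w' = True # x'" using w False by auto
      with far[of x' x] Suc.prems(1,2) show ?thesis by (simp only: abs_minus_commute)
    qed
    also have "\<dots> = dist (walk_point w l $ i) (walk_point w' l $ i)"
      by (simp add: walk_point_def dist_real_def)
    also have "\<dots> \<le> dist (walk_point w l) (walk_point w' l)" by (rule dist_vec_nth_le)
    finally have "3 / 8 * (1/2) ^ l \<le> dist (walk_point w l) (walk_point w' l)" .
    moreover have "(1/2::real) ^ K \<le> (1/2) ^ l" using l(2) by (intro power_decreasing) auto
    ultimately have "3 / 8 * (1/2) ^ K \<le> dist (walk_point w l) (walk_point w' l)" by linarith
    thus ?thesis by (intro exI[of _ 0]) auto
  qed
qed simp

text \<open>For fixed \<open>K\<close> the separation scale does not depend on \<open>n\<close>,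
  while the killed walks grow like \<open>(2 * cos (pi / K)) ^ n\<close>. The supremum over scales
  then permits \<open>K\<close> to tend to infinity.\<close>

lemma topological_entropy_T_ge: "ereal (ln 2) \<le> topological_entropy T unit_cube"
proof -
  have le: "ereal (ln (2 * cos (pi / real K))) \<le> topological_entropy T unit_cube" if "K \<ge> 3" for K
  proof (rule topological_entropy_ge)
    have K: "0 < pi / K" using that by simp
    have "pi / K < pi / 2" by (rule divide_strict_left_mono) (use that in auto)
    note K = K this
    show "3 / 16 * (1/2::real) ^ K > 0" by simp
    show "sin (pi / K) > 0" using K by (intro sin_gt_zero) (use pi_gt_zero in linarith)+
    show "2 * cos (pi / K) > 0" using K by (simp add: cos_gt_zero)
    fix n :: nat
    define S where "S = (\<lambda>w. walk_point w 1) ` walks K n 1"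
    have sep: "\<exists>k<n. 3 / 8 * (1/2) ^ K \<le> dist ((T ^^ k) (walk_point w 1)) ((T ^^ k) (walk_point w' 1))"
      if "w \<in> walks K n 1" "w' \<in> walks K n 1" "w \<noteq> w'" for w w'
      using walk_points_separated that by blast
    have "inj_on (\<lambda>w. walk_point w 1) (walks K n 1)"
    proof (rule inj_onI, rule ccontr)
      fix w w' assume "w \<in> walks K n 1" "w' \<in> walks K n 1" "walk_point w 1 = walk_point w' 1" "w \<noteq> w'"
      moreover from this(1,2,4) obtain k where
        "3 / 8 * (1/2) ^ K \<le> dist ((T ^^ k) (walk_point w 1)) ((T ^^ k) (walk_point w' 1))"
        using sep by blast
      ultimately have "3 / 8 * (1/2) ^ K \<le> (0::real)" by (simp only: dist_self)
      moreover have "3 / 8 * (1/2) ^ K > (0::real)" by simp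
      ultimately show False by linarith
    qed
    hence "card S = card (walks K n 1)" unfolding S_def by (rule card_image)
    hence "sin (pi / K) * (2 * cos (pi / K)) ^ n \<le> card S"
      using card_walks_ge[of K 1 n] that by (simp add: mult.commute)
    moreover have "S \<subseteq> unit_cube"
    proof -
      have "walk_point w 1 \<in> unit_cube" if "w \<in> walks K n 1" for w
        using walk_pos_bounds[OF that] unfolding walk_point_def by (intro plane_point_in_cube) auto
      thus ?thesis unfolding S_def by blast
    qed
    moreover have "\<exists>k<n. 2 * (3 / 16 * (1/2) ^ K) \<le> dist ((T ^^ k) x) ((T ^^ k) y)"
      if xy: "x \<in> S" "y \<in> S" "x \<noteq> y" for x y
    proof -
      obtain w w' where w: "x = walk_point w 1" "y = walk_point w' 1" "w \<in> walks K n 1" "w' \<in> walks K n 1"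
        using xy unfolding S_def by blast
      have "2 * (3 / 16 * (1/2) ^ K) = (3 / 8 * (1/2) ^ K :: real)" by simp
      thus ?thesis using sep[OF w(3,4)] xy(3) unfolding w(1,2) by metis
    qed
    ultimately show "\<exists>S\<subseteq>unit_cube. sin (pi / K) * (2 * cos (pi / K)) ^ n \<le> card S \<and>
      (\<forall>x\<in>S. \<forall>y\<in>S. x \<noteq> y \<longrightarrow> (\<exists>k<n. 2 * (3 / 16 * (1/2) ^ K) \<le> dist ((T ^^ k) x) ((T ^^ k) y)))"
      by blast
  qed
  have "(\<lambda>K. ln (2 * cos (pi / real K))) \<longlonglongrightarrow> ln (2 * cos 0)"
    by (intro tendsto_intros lim_const_over_n) auto
  hence "(\<lambda>K. ereal (ln (2 * cos (pi / real K)))) \<longlonglongrightarrow> ereal (ln 2)" by simp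
  thus ?thesis
    by (rule tendsto_upperbound) (auto simp: eventually_sequentially intro!: exI[of _ 3] le)
qed

end

section \<open>Invariant measures with entropy close to \<open>ln 2\<close>\<close>

text \<open>Truncated subtraction keeps level 0 fixed under \<open>True\<close>, which mirrors the
  cut-off of the height at 1.\<close>

definition reflect_step :: "bool \<Rightarrow> nat \<Rightarrow> nat" where
  "reflect_step b l = (if b then l - 1 else l + 1)"

text \<open>A skew product over the one-sided shift: the coin that is shifted out drives the
  level.\<close>

definition walk_map :: "(nat \<Rightarrow> bool) \<times> nat \<Rightarrow> (nat \<Rightarrow> bool) \<times> nat" where
  "walk_map x = (\<lambda>n. fst x (Suc n), reflect_step (fst x 0) (snd x))"

lemma fst_walk_map_funpow: "fst ((walk_map ^^ k) x) n = fst x (n + k)"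
  by (induction k arbitrary: n) (auto simp: walk_map_def)

text \<open>Counterpart of \<open>walk_pos\<close> for infinite coin sequences: the first
  \<open>n\<close> inverse branches applied to position 0. Contraction by 4 makes these positions
  converge.\<close>

fun code_approx :: "nat \<Rightarrow> (nat \<Rightarrow> bool) \<times> nat \<Rightarrow> real" where
  "code_approx 0 x = 0"
| "code_approx (Suc n) x =
     (if fst x 0 then (1/2) ^ snd x - code_approx n (walk_map x) / 4 else code_approx n (walk_map x) / 4)"

definition code_pos :: "(nat \<Rightarrow> bool) \<times> nat \<Rightarrow> real" where
  "code_pos x = lim (\<lambda>n. code_approx n x)"

lemma half_power_reflect: "(1/2::real) ^ reflect_step b l = (if b then min 1 (2 * (1/2) ^ l) else (1/2) ^ l / 2)"
proof (cases l)
  case (Suc k)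
  have "(1/2::real) ^ k \<le> 1" by (simp add: power_le_one)
  thus ?thesis using Suc by (simp add: reflect_step_def)
qed (simp add: reflect_step_def)

lemma code_approx_bounds: "0 \<le> code_approx n x \<and> code_approx n x \<le> (1/2) ^ snd x"
proof (induction n arbitrary: x)
  case (Suc n)
  have s: "snd (walk_map x) = reflect_step (fst x 0) (snd x)" by (simp add: walk_map_def)
  have "(1/2::real) ^ snd x > 0" by simp
  with Suc[of "walk_map x", unfolded s half_power_reflect] show ?case by (auto split: if_splits)
qed auto

lemma code_approx_diff: "\<bar>code_approx (Suc n) x - code_approx n x\<bar> \<le> (1/4) ^ n"
proof (induction n arbitrary: x)
  case 0
  have "(1/2::real) ^ snd x \<le> 1" by (simp add: power_le_one)
  thus ?case using code_approx_bounds[of 1 x] by simp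
next
  case (Suc n)
  have e: "code_approx (Suc m) x
      = (if fst x 0 then (1/2) ^ snd x - code_approx m (walk_map x) / 4 else code_approx m (walk_map x) / 4)" for m
    by simp
  let ?a = "code_approx (Suc n) (walk_map x)" and ?b = "code_approx n (walk_map x)"
  have "code_approx (Suc (Suc n)) x - code_approx (Suc n) x = (if fst x 0 then ?b - ?a else ?a - ?b) / 4"
    unfolding e[of "Suc n"] e[of n] by (simp add: diff_divide_distrib del: code_approx.simps)
  moreover have "\<bar>(if fst x 0 then ?b - ?a else ?a - ?b) / 4\<bar> \<le> (1/4) ^ Suc n"
    using Suc[of "walk_map x"] by (simp add: abs_minus_commute del: code_approx.simps)
  ultimately show ?case by (simp only:)
qed

lemma code_approx_LIMSEQ: "(\<lambda>n. code_approx n x) \<longlonglongrightarrow> code_pos x"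
proof -
  have "summable (\<lambda>n. code_approx (Suc n) x - code_approx n x)"
    by (rule summable_comparison_test'[of "\<lambda>n. (1/4) ^ n" 0])
      (use code_approx_diff in \<open>auto simp: summable_geometric simp del: code_approx.simps\<close>)
  hence "convergent (\<lambda>n. code_approx n x - code_approx 0 x)"
    by (simp only: summable_iff_convergent sum_lessThan_telescope[of "\<lambda>n. code_approx n x"])
  thus ?thesis unfolding code_pos_def by (simp add: convergent_LIMSEQ_iff)
qed

lemma code_pos_rec:
  "code_pos x = (if fst x 0 then (1/2) ^ snd x - code_pos (walk_map x) / 4 else code_pos (walk_map x) / 4)"
proof (rule LIMSEQ_unique)
  show "(\<lambda>n. code_approx (Suc n) x) \<longlonglongrightarrow> code_pos x"
    using code_approx_LIMSEQ by (rule LIMSEQ_Suc)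
  show "(\<lambda>n. code_approx (Suc n) x) \<longlonglongrightarrow>
    (if fst x 0 then (1/2) ^ snd x - code_pos (walk_map x) / 4 else code_pos (walk_map x) / 4)"
    by (auto intro!: tendsto_intros code_approx_LIMSEQ)
qed

lemma code_pos_bounds: "0 \<le> code_pos x" "code_pos x \<le> (1/2) ^ snd x"
  using code_approx_bounds[of _ x]
  by (auto intro!: LIMSEQ_le_const[OF code_approx_LIMSEQ] LIMSEQ_le_const2[OF code_approx_LIMSEQ] exI[of _ 0])

context cone_map begin

definition code_point :: "(nat \<Rightarrow> bool) \<times> nat \<Rightarrow> real ^ 'n" where
  "code_point x = plane_point (code_pos x) ((1/2) ^ snd x)"

lemma code_point_in_cube: "code_point x \<in> unit_cube"
proof -
  have "(1/2::real) ^ snd x \<le> 1" by (simp add: power_le_one)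
  thus ?thesis unfolding code_point_def
    using code_pos_bounds[of x] by (intro plane_point_in_cube) auto
qed

text \<open>By \<open>code_pos_rec\<close>, \<open>code_point x\<close> is the preimage of
  \<open>code_point (walk_map x)\<close> in the sector named by the first coin. Hence
  \<open>code_point\<close> semiconjugates \<open>walk_map\<close> to \<open>T\<close> and turns
  coins into symbols.\<close>

lemma
  shows T_code_point: "T (code_point x) = code_point (walk_map x)"
    and upper_code_point: "upper (code_point x) \<longleftrightarrow> fst x 0"
proof -
  have v: "(1/2::real) ^ snd x \<le> 1" "(1/2::real) ^ snd x > 0" by (auto simp: power_le_one)
  have s: "snd (walk_map x) = reflect_step (fst x 0) (snd x)" by (simp add: walk_map_def)
  note b = code_pos_bounds[of "walk_map x", unfolded s half_power_reflect]
  have "T (code_point x) = code_point (walk_map x) \<and> (upper (code_point x) \<longleftrightarrow> fst x 0)"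
  proof (cases "fst x 0")
    case True
    thus ?thesis unfolding code_point_def code_pos_rec[of x] s half_power_reflect
      using T_plane_upper(1,2)[of "code_pos (walk_map x)" "(1/2) ^ snd x"] b v by simp
  next
    case False
    thus ?thesis unfolding code_point_def code_pos_rec[of x] s half_power_reflect
      using T_plane_lower(1,2)[of "code_pos (walk_map x)" "(1/2) ^ snd x"] b v by simp
  qed
  thus "T (code_point x) = code_point (walk_map x)" "upper (code_point x) \<longleftrightarrow> fst x 0" by auto
qed

lemma funpow_T_code_point: "(T ^^ k) (code_point x) = code_point ((walk_map ^^ k) x)"
  by (induction k) (auto simp: T_code_point)

end

section \<open>The walk driven by coins biased towards greater height, and its stationary
  law\<close>

locale biased_walk =
  fixes p :: real
  assumes p: "1/2 < p" "p < 1"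
begin

definition bits :: "(nat \<Rightarrow> bool) measure" where
  "bits = (\<Pi>\<^sub>M i\<in>UNIV. measure_pmf (bernoulli_pmf p))"

definition levels :: "nat pmf" where
  "levels = geometric_pmf (1 - (1 - p) / p)"

definition walk_measure :: "((nat \<Rightarrow> bool) \<times> nat) measure" where
  "walk_measure = bits \<Otimes>\<^sub>M measure_pmf levels"

sublocale bits: sequence_space "measure_pmf (bernoulli_pmf p)"
  by unfold_locales

lemma prob_space_bits: "prob_space bits"
  unfolding bits_def by (rule bits.P.prob_space_axioms)

lemma space_bits [simp]: "space bits = UNIV"
  by (auto simp: bits_def space_PiM)

lemma pmf_levels: "pmf levels k = ((1 - p) / p) ^ k * (1 - (1 - p) / p)"
  unfolding levels_def using p by (subst pmf_geometric) (auto simp: field_simps)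

text \<open>With ratio \<open>r = (1 - p) / p\<close>, the flow \<open>p * r\<close> from level
  \<open>k + 1\<close> down balances the flow \<open>1 - p\<close> from level \<open>k\<close> up.
  Level 0 is computed apart, because it is reached by \<open>True\<close> from both 0 and 1.\<close>

lemma levels_stationary:
  "levels = bind_pmf (bernoulli_pmf p) (\<lambda>b. map_pmf (reflect_step b) levels)"
proof (rule pmf_eqI)
  fix k
  define r where "r = (1 - p) / p"
  have r: "p * r = 1 - p" using p by (simp add: r_def)
  have down: "pmf (map_pmf (reflect_step True) levels) k = (if k = 0 then (1 - r) * (1 + r) else r ^ Suc k * (1 - r))"
  proof (cases "k = 0")
    case True
    have "reflect_step True -` {0} = {0, Suc 0}" by (auto simp: reflect_step_def)
    thus ?thesis using True
      by (simp add: pmf_map measure_measure_pmf_finite pmf_levels r_def[symmetric] algebra_simps)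
  next
    case False
    hence "reflect_step True -` {k} = {Suc k}" by (auto simp: reflect_step_def)
    thus ?thesis using False
      by (simp add: pmf_map measure_measure_pmf_finite pmf_levels r_def[symmetric])
  qed
  have up: "pmf (map_pmf (reflect_step False) levels) k = (if k = 0 then 0 else r ^ (k - 1) * (1 - r))"
  proof (cases k)
    case 0
    have "reflect_step False -` {0} = {}" by (auto simp: reflect_step_def)
    thus ?thesis using 0 by (simp add: pmf_map)
  next
    case (Suc m)
    hence "reflect_step False -` {k} = {m}" by (auto simp: reflect_step_def)
    thus ?thesis using Suc
      by (simp add: pmf_map measure_measure_pmf_finite pmf_levels r_def[symmetric])
  qed
  have "pmf (bind_pmf (bernoulli_pmf p) (\<lambda>b. map_pmf (reflect_step b) levels)) k
      = pmf (map_pmf (reflect_step True) levels) k * p + pmf (map_pmf (reflect_step False) levels) k * (1 - p)"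
    using p by (simp add: pmf_bind)
  also have "\<dots> = pmf levels k"
  proof (cases k)
    case 0
    have "(1 - r) * (1 + r) * p = (1 - r) * (p + p * r)" by (simp add: algebra_simps)
    thus ?thesis using 0 r unfolding down up by (simp add: pmf_levels r_def[symmetric])
  next
    case (Suc m)
    have "r * r * p + (1 - p) = r"
    proof -
      have "r * r * p = r * (p * r)" by simp
      also have "\<dots> + (1 - p) = (1 - p) * (r + 1)" unfolding r by (simp add: algebra_simps)
      also have "\<dots> = r * (p * r + p)" unfolding r[symmetric] by (simp add: algebra_simps)
      finally show ?thesis unfolding r by simp
    qed
    hence "r ^ m * (1 - r) * (r * r * p + (1 - p)) = r ^ m * (1 - r) * r" by simp
    thus ?thesis using Suc unfolding down up by (simp add: pmf_levels r_def[symmetric] algebra_simps)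
  qed
  finally show "pmf levels k = pmf (bind_pmf (bernoulli_pmf p) (\<lambda>b. map_pmf (reflect_step b) levels)) k" ..
qed

sublocale walk: prob_space walk_measure
  unfolding walk_measure_def
  by (intro prob_space_pair prob_space_bits measure_pmf.prob_space_axioms)

lemma space_walk_measure [simp]: "space walk_measure = UNIV"
  by (simp add: walk_measure_def space_pair_measure)

lemma measurable_bit [measurable]: "(\<lambda>\<omega>. \<omega> n) \<in> bits \<rightarrow>\<^sub>M count_space UNIV"
proof -
  have "(\<lambda>\<omega>. \<omega> n) \<in> bits \<rightarrow>\<^sub>M measure_pmf (bernoulli_pmf p)"
    unfolding bits_def by (rule measurable_component_singleton) simp
  thus ?thesis by simp
qed

lemma measurable_shift [measurable]: "(\<lambda>\<omega> n. \<omega> (Suc n)) \<in> bits \<rightarrow>\<^sub>M bits"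
proof -
  have "(\<lambda>\<omega>. \<lambda>n\<in>UNIV. \<omega> (Suc n)) \<in> bits \<rightarrow>\<^sub>M (\<Pi>\<^sub>M i\<in>UNIV. measure_pmf (bernoulli_pmf p))"
    by (rule measurable_restrict) simp
  thus ?thesis by (simp add: bits_def restrict_UNIV)
qed

lemma measurable_bit_walk [measurable]: "(\<lambda>x. fst x n) \<in> walk_measure \<rightarrow>\<^sub>M count_space UNIV"
  unfolding walk_measure_def
  by (rule measurable_compose[OF measurable_fst measurable_bit])

lemma measurable_level_walk [measurable]: "snd \<in> walk_measure \<rightarrow>\<^sub>M count_space UNIV"
proof -
  have "snd \<in> walk_measure \<rightarrow>\<^sub>M measure_pmf levels" unfolding walk_measure_def by simp
  thus ?thesis by simp
qed

lemma measurable_walk_map [measurable]: "walk_map \<in> walk_measure \<rightarrow>\<^sub>M walk_measure"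
proof -
  have 1: "(\<lambda>x. (\<lambda>n. fst x (Suc n))) \<in> walk_measure \<rightarrow>\<^sub>M bits"
    unfolding walk_measure_def by (rule measurable_compose[OF measurable_fst measurable_shift])
  have "(\<lambda>x. reflect_step (fst x 0) (snd x)) \<in> walk_measure \<rightarrow>\<^sub>M count_space UNIV"
    unfolding reflect_step_def
    by (intro measurable_If measurable_compose[OF measurable_level_walk] predE measurable_bit_walk) auto
  hence 2: "(\<lambda>x. reflect_step (fst x 0) (snd x)) \<in> walk_measure \<rightarrow>\<^sub>M measure_pmf levels"
    by (simp only: measurable_pmf_measure2)
  show ?thesis unfolding walk_map_def[abs_def]
    using measurable_Pair[OF 1 2] by (simp only: walk_measure_def)
qed

text \<open>\<open>PiM_iter\<close> presents a coin sequence as an independent first coin followed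
  by a sequence with the same law.\<close>

lemma emeasure_bits_Suc:
  assumes A: "A \<in> sets bits"
  shows "emeasure bits {\<omega>. \<omega> 0 = b \<and> (\<lambda>n. \<omega> (Suc n)) \<in> A} = ennreal (pmf (bernoulli_pmf p) b) * emeasure bits A"
proof -
  let ?B = "measure_pmf (bernoulli_pmf p)"
  interpret b: prob_space bits by (rule prob_space_bits)
  let ?X = "{\<omega>. \<omega> 0 = b \<and> (\<lambda>n. \<omega> (Suc n)) \<in> A}"
  have X: "?X \<in> sets bits"
  proof -
    have "(\<lambda>\<omega>. \<omega> 0) -` {b} \<inter> space bits \<inter> ((\<lambda>\<omega> n. \<omega> (Suc n)) -` A \<inter> space bits) \<in> sets bits"
      using A by (intro sets.Int measurable_sets[OF measurable_bit] measurable_sets[OF measurable_shift]) auto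
    also have "(\<lambda>\<omega>. \<omega> 0) -` {b} \<inter> space bits \<inter> ((\<lambda>\<omega> n. \<omega> (Suc n)) -` A \<inter> space bits) = ?X" by auto
    finally show ?thesis .
  qed
  have m: "(\<lambda>(s, \<omega>). case_nat s \<omega>) \<in> ?B \<Otimes>\<^sub>M bits \<rightarrow>\<^sub>M bits"
    unfolding bits_def by measurable
  have "emeasure bits ?X = emeasure (distr (?B \<Otimes>\<^sub>M bits) bits (\<lambda>(s, \<omega>). case_nat s \<omega>)) ?X"
    using bits.PiM_iter by (simp add: bits_def)
  also have "\<dots> = emeasure (?B \<Otimes>\<^sub>M bits) ((\<lambda>(s, \<omega>). case_nat s \<omega>) -` ?X \<inter> space (?B \<Otimes>\<^sub>M bits))"
    using m X by (rule emeasure_distr)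
  also have "(\<lambda>(s, \<omega>). case_nat s \<omega>) -` ?X \<inter> space (?B \<Otimes>\<^sub>M bits) = {b} \<times> A"
    by (auto simp: space_pair_measure)
  also have "emeasure (?B \<Otimes>\<^sub>M bits) ({b} \<times> A) = emeasure ?B {b} * emeasure bits A"
    using A by (intro b.emeasure_pair_measure_Times) auto
  finally show ?thesis by (simp add: emeasure_pmf_single)
qed

lemma distr_walk_map: "distr walk_measure walk_measure walk_map = walk_measure"
proof -
  interpret b: prob_space bits by (rule prob_space_bits)
  have "bits \<Otimes>\<^sub>M measure_pmf levels = distr walk_measure walk_measure walk_map"
  proof (rule pair_measure_eqI)
    show "sigma_finite_measure bits" by unfold_locales
    show "sigma_finite_measure (measure_pmf levels)" by unfold_locales
    show "sets (bits \<Otimes>\<^sub>M measure_pmf levels) = sets (distr walk_measure walk_measure walk_map)"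
      by (simp add: walk_measure_def)
    fix A B assume A: "A \<in> sets bits" and "B \<in> sets (measure_pmf levels)"
    \<comment> \<open>The preimage of a rectangle splits by the first coin into two rectangles: for
      a given coin, the shifted sequence and the next level are functions of separate factors.
      Summing over the coin leaves the stationarity of \<open>levels\<close>.\<close>
    let ?X = "\<lambda>b. {\<omega>. \<omega> 0 = b \<and> (\<lambda>n. \<omega> (Suc n)) \<in> A} \<times> {l. reflect_step b l \<in> B}"
    have X0: "{\<omega>. \<omega> 0 = b \<and> (\<lambda>n. \<omega> (Suc n)) \<in> A} \<in> sets bits" for b
    proof -
      have "(\<lambda>\<omega>. \<omega> 0) -` {b} \<inter> space bits \<inter> ((\<lambda>\<omega> n. \<omega> (Suc n)) -` A \<inter> space bits) \<in> sets bits"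
        using A by (intro sets.Int measurable_sets[OF measurable_bit] measurable_sets[OF measurable_shift]) auto
      also have "(\<lambda>\<omega>. \<omega> 0) -` {b} \<inter> space bits \<inter> ((\<lambda>\<omega> n. \<omega> (Suc n)) -` A \<inter> space bits)
          = {\<omega>. \<omega> 0 = b \<and> (\<lambda>n. \<omega> (Suc n)) \<in> A}" by auto
      finally show ?thesis .
    qed
    have X: "?X b \<in> sets walk_measure" for b
      unfolding walk_measure_def using X0 by (intro pair_measureI) auto
    have eX: "emeasure walk_measure (?X b)
        = ennreal (pmf (bernoulli_pmf p) b) * emeasure bits A * emeasure (map_pmf (reflect_step b) levels) B" for b
    proof -
      have "emeasure walk_measure (?X b)
          = emeasure bits {\<omega>. \<omega> 0 = b \<and> (\<lambda>n. \<omega> (Suc n)) \<in> A} * emeasure levels {l. reflect_step b l \<in> B}"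
        unfolding walk_measure_def using X0
        by (intro measure_pmf.emeasure_pair_measure_Times) auto
      thus ?thesis by (simp add: emeasure_bits_Suc[OF A] vimage_def)
    qed
    have AB: "A \<times> B \<in> sets walk_measure" unfolding walk_measure_def using A by (intro pair_measureI) auto
    have "emeasure (distr walk_measure walk_measure walk_map) (A \<times> B)
        = emeasure walk_measure (walk_map -` (A \<times> B) \<inter> space walk_measure)"
      using AB by (intro emeasure_distr) auto
    also have "walk_map -` (A \<times> B) \<inter> space walk_measure = ?X True \<union> ?X False"
    proof (rule set_eqI)
      fix x
      show "x \<in> walk_map -` (A \<times> B) \<inter> space walk_measure \<longleftrightarrow> x \<in> ?X True \<union> ?X False"
        by (cases x; cases "fst x 0") (auto simp: walk_map_def)
    qed
    also have "emeasure walk_measure (?X True \<union> ?X False)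
        = emeasure walk_measure (?X True) + emeasure walk_measure (?X False)"
      by (rule plus_emeasure[OF X X, symmetric]) auto
    also have "\<dots> = emeasure bits A * (emeasure (map_pmf (reflect_step True) levels) B * p
         + emeasure (map_pmf (reflect_step False) levels) B * (1 - p))"
      unfolding eX using p by (simp add: algebra_simps del: emeasure_map_pmf)
    also have "emeasure (map_pmf (reflect_step True) levels) B * p
         + emeasure (map_pmf (reflect_step False) levels) B * (1 - p)
       = emeasure (bind_pmf (bernoulli_pmf p) (\<lambda>b. map_pmf (reflect_step b) levels)) B"
      using p by (simp del: emeasure_map_pmf)
    also have "bind_pmf (bernoulli_pmf p) (\<lambda>b. map_pmf (reflect_step b) levels) = levels"
      by (rule levels_stationary[symmetric])
    finally show "emeasure bits A * emeasure (measure_pmf levels) B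
        = emeasure (distr walk_measure walk_measure walk_map) (A \<times> B)" ..
  qed
  thus ?thesis by (simp add: walk_measure_def)
qed

text \<open>Each of the \<open>n\<close> independent factors is \<open>p\<close> or
  \<open>1 - p\<close>, and \<open>p\<close> is the larger. This crude bound suffices because
  \<open>- ln p\<close> tends to \<open>ln 2\<close> as the bias vanishes.\<close>

lemma
  shows cylinder_sets: "{x. \<forall>k<n. fst x k = b k} \<in> sets walk_measure"
    and prob_cylinder_le: "walk.prob {x. \<forall>k<n. fst x k = b k} \<le> p ^ n"
proof -
  interpret b: prob_space bits by (rule prob_space_bits)
  let ?C = "{\<omega>. \<forall>k<n. \<omega> k = b k}"
  have eq: "?C = {\<omega>\<in>space (\<Pi>\<^sub>M i\<in>UNIV. measure_pmf (bernoulli_pmf p)). \<forall>k\<in>{..<n}. \<omega> k \<in> {b k}}"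
    by (auto simp: space_PiM)
  have C: "?C \<in> sets bits"
  proof -
    have "{\<omega> \<in> space bits. \<forall>k<n. \<omega> k = b k} \<in> sets bits" by measurable
    thus ?thesis by simp
  qed
  have prod: "?C \<times> UNIV = {x::(nat \<Rightarrow> bool) \<times> nat. \<forall>k<n. fst x k = b k}" by auto
  have "?C \<times> UNIV \<in> sets walk_measure"
    unfolding walk_measure_def using C by (intro pair_measureI) auto
  thus "{x. \<forall>k<n. fst x k = b k} \<in> sets walk_measure" unfolding prod .
  have "emeasure bits ?C = (\<Prod>k<n. emeasure (measure_pmf (bernoulli_pmf p)) {b k})"
    unfolding bits_def eq by (rule bits.emeasure_PiM_Collect) auto
  also have "\<dots> = ennreal (\<Prod>k<n. pmf (bernoulli_pmf p) (b k))"
    by (simp add: emeasure_pmf_single prod_ennreal)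
  also have "(\<Prod>k<n. pmf (bernoulli_pmf p) (b k)) \<le> (\<Prod>k<n. p)"
  proof (rule prod_mono)
    fix k
    show "0 \<le> pmf (bernoulli_pmf p) (b k) \<and> pmf (bernoulli_pmf p) (b k) \<le> p"
      using p by (cases "b k") auto
  qed
  also have "(\<Prod>k<n. p) = p ^ n" by simp
  finally have *: "emeasure bits ?C \<le> ennreal (p ^ n)" by (simp add: ennreal_leI)
  have "emeasure walk_measure (?C \<times> UNIV) = emeasure bits ?C * emeasure (measure_pmf levels) UNIV"
    unfolding walk_measure_def using C by (intro measure_pmf.emeasure_pair_measure_Times) auto
  also note prod
  finally have "emeasure walk_measure {x. \<forall>k<n. fst x k = b k} \<le> ennreal (p ^ n)"
    using * by simp
  thus "walk.prob {x. \<forall>k<n. fst x k = b k} \<le> p ^ n" using p by (simp add: walk.emeasure_eq_measure)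
qed

end


section \<open>From biased walks to invariant measures of the cone map\<close>

lemma ks_entropy_ge:
  assumes M: "M \<in> invariant_measures T X" and P: "measurable_partition M P"
    and le: "\<And>n. n > 0 \<Longrightarrow> n * c \<le> label_entropy M (itinerary T (cell_of P) n)"
  shows "ereal c \<le> ks_entropy T M"
proof -
  interpret invariant_system M T by (rule invariant_system_of_invariant_measure[OF M])
  have part: "partition_on (space M) P" using P by (simp add: measurable_partition_def)
  have "ereal c = limsup (\<lambda>n. ereal c)" by (simp add: Limsup_const)
  also have "\<dots> \<le> entropy_wrt_partition T M P"
    unfolding entropy_wrt_partition_def partition_entropy_iterated_join[OF part]
  proof (rule Limsup_mono, rule eventually_mono[OF eventually_gt_at_top[of 0]])
    fix n :: nat assume "n > 0"
    thus "ereal c \<le> ereal (label_entropy M (itinerary T (cell_of P) n) / real n)"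
      using le[of n] by (simp add: field_simps)
  qed
  also have "\<dots> \<le> ks_entropy T M"
    unfolding ks_entropy_def using P by (intro SUP_upper) auto
  finally show ?thesis .
qed

context cone_map begin

text \<open>The image of \<open>walk_measure\<close> under \<open>code_point\<close> is invariant by
  semiconjugacy. A symbol word pulls back into a coin cylinder of mass at most \<open>p ^ n\<close>,
  so words of length \<open>n\<close> have entropy at least \<open>n * (- ln p)\<close>.\<close>

lemma ks_entropy_biased_walk:
  assumes "1/2 < p" "p < 1"
  shows "\<exists>M\<in>invariant_measures T unit_cube. ereal (- ln p) \<le> ks_entropy T M"
proof -
  interpret biased_walk p by standard fact+
  let ?X = "restrict_space borel (unit_cube :: (real ^ 'n) set)"
  have lev: "(\<lambda>x. (1/2::real) ^ snd x) \<in> borel_measurable walk_measure"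
    by (rule measurable_compose[OF measurable_level_walk]) simp
  have ca: "code_approx n \<in> borel_measurable walk_measure" for n
  proof (induction n)
    case 0
    have "code_approx 0 = (\<lambda>x. 0)" by auto
    thus ?case by simp
  next
    case (Suc n)
    have c: "(\<lambda>x. code_approx n (walk_map x) / 4) \<in> borel_measurable walk_measure"
      by (intro borel_measurable_divide measurable_compose[OF measurable_walk_map Suc]) simp
    have "(\<lambda>x. if fst x 0 then (1/2) ^ snd x - code_approx n (walk_map x) / 4 else code_approx n (walk_map x) / 4)
        \<in> borel_measurable walk_measure"
      by (intro measurable_If borel_measurable_diff lev c predE measurable_bit_walk)
    moreover have "code_approx (Suc n) = (\<lambda>x. if fst x 0 then (1/2) ^ snd x - code_approx n (walk_map x) / 4
        else code_approx n (walk_map x) / 4)" by (rule ext) simp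
    ultimately show ?case by (simp only:)
  qed
  have cp: "code_pos \<in> borel_measurable walk_measure"
    by (rule borel_measurable_LIMSEQ_metric[OF ca]) (rule code_approx_LIMSEQ)
  have code: "code_point \<in> walk_measure \<rightarrow>\<^sub>M ?X"
  proof (rule measurable_restrict_space2)
    show "code_point \<in> walk_measure \<rightarrow>\<^sub>M borel"
    proof -
      have "code_point = (\<lambda>x. code_pos x *\<^sub>R axis i 1 + (1/2) ^ snd x *\<^sub>R axis j 1)"
        using i_neq_j by (auto simp: fun_eq_iff vec_eq_iff code_point_def plane_point_def axis_def)
      thus ?thesis using cp lev by simp
    qed
  qed (use code_point_in_cube in auto)
  define M where "M = distr walk_measure ?X code_point"
  have sets_M: "sets M = sets ?X" by (simp add: M_def)
  have space_M: "space M = unit_cube" by (simp add: M_def space_restrict_space)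
  have TM: "T \<in> M \<rightarrow>\<^sub>M M" using measurable_T by (simp add: M_def)
  have "distr M M T = distr M ?X T" by (rule distr_cong) (auto simp: sets_M)
  also have "\<dots> = distr walk_measure ?X (T \<circ> code_point)"
    unfolding M_def by (rule distr_distr[OF measurable_T code])
  also have "T \<circ> code_point = code_point \<circ> walk_map" by (auto simp: T_code_point)
  also have "distr walk_measure ?X (code_point \<circ> walk_map)
      = distr (distr walk_measure walk_measure walk_map) ?X code_point"
    by (rule distr_distr[OF code measurable_walk_map, symmetric])
  also have "\<dots> = M" by (simp add: distr_walk_map M_def)
  finally have M: "M \<in> invariant_measures T unit_cube"
    using sets_M TM walk.prob_space_distr[OF code] by (simp add: invariant_measures_def M_def)
  interpret invariant_system M T by (rule invariant_system_of_invariant_measure[OF M])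
  define U where "U = {p \<in> unit_cube. upper p}"
  have U: "U \<in> sets M" unfolding U_def sets_M by (rule measurable_upper)
  \<comment> \<open>\<open>partition_on\<close> forbids empty cells, hence the removal of the empty
    set.\<close>
  define P where "P = {U, unit_cube - U} - {{}}"
  have PU: "A = U \<or> A = unit_cube - U" if "A \<in> P" for A using that by (auto simp: P_def)
  have part: "partition_on unit_cube P"
    by (auto simp: partition_on_def disjoint_def P_def U_def)
  have mp: "measurable_partition M P"
    unfolding measurable_partition_def space_M using part U sets.compl_sets[OF U]
    by (auto simp: P_def space_M)
  have bound: "prob (itinerary T (cell_of P) n -` {w} \<inter> space M) \<le> exp (- (n * (- ln p)))" for n w
  proof (cases "itinerary T (cell_of P) n -` {w} \<inter> space M = {}")
    case False
    then obtain p0 where p0: "p0 \<in> unit_cube" "itinerary T (cell_of P) n p0 = w" by (auto simp: space_M)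
    define b where "b k = upper ((T ^^ k) p0)" for k
    have up: "upper ((T ^^ k) q) = b k"
      if "q \<in> unit_cube" "itinerary T (cell_of P) n q = w" "k < n" for q k
    proof -
      have "cell_of P ((T ^^ k) q) = cell_of P ((T ^^ k) p0)"
        using that p0(2) itinerary_eq_iff by metis
      moreover note cell_of_in[OF part funpow_T_in_cube[OF that(1)], of k]
        cell_of_in[OF part funpow_T_in_cube[OF p0(1)], of k]
      ultimately show ?thesis
        using PU[of "cell_of P ((T ^^ k) q)"] unfolding b_def U_def by auto
    qed
    define A where "A = itinerary T (cell_of P) n -` {w} \<inter> space M"
    have "A \<in> sets M" unfolding A_def
      using simple_function_itinerary[OF simple_function_cell_of[OF mp]] by (rule simple_functionD)
    hence "A \<in> sets ?X" by (simp only: sets_M)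
    hence "measure M A = walk.prob (code_point -` A \<inter> space walk_measure)"
      unfolding M_def by (rule measure_distr[OF code])
    also have "\<dots> \<le> walk.prob {x. \<forall>k<n. fst x k = b k}"
    proof (rule walk.finite_measure_mono)
      show "code_point -` A \<inter> space walk_measure \<subseteq> {x. \<forall>k<n. fst x k = b k}"
      proof
        fix x assume "x \<in> code_point -` A \<inter> space walk_measure"
        hence "upper ((T ^^ k) (code_point x)) = b k" if "k < n" for k
          using that up[of "code_point x" k] by (auto simp: A_def space_M)
        thus "x \<in> {x. \<forall>k<n. fst x k = b k}"
          by (simp add: funpow_T_code_point upper_code_point fst_walk_map_funpow)
      qed
    qed (rule cylinder_sets)
    also have "\<dots> \<le> p ^ n" by (rule prob_cylinder_le)
    also have "p ^ n = exp (- (n * (- ln p)))" using assms by (simp add: exp_of_nat_mult)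
    finally show ?thesis unfolding A_def .
  qed simp
  have "ereal (- ln p) \<le> ks_entropy T M"
    by (rule ks_entropy_ge[OF M mp],
        rule label_entropy_ge[OF simple_function_itinerary[OF simple_function_cell_of[OF mp]] bound])
  thus ?thesis using M by blast
qed

lemma SUP_ks_entropy_ge:
  "ereal (ln 2) \<le> (SUP M\<in>invariant_measures T unit_cube. ks_entropy T M)"
proof -
  have le: "ereal (- ln (1/2 + 1 / n)) \<le> (SUP M\<in>invariant_measures T unit_cube. ks_entropy T M)"
    if n: "n > 2" for n :: nat
  proof -
    have "1 / real n < 1 / 2" using n by (simp add: field_simps)
    moreover have "1 / real n > 0" using n by simp
    ultimately obtain M where "M \<in> invariant_measures T unit_cube" "ereal (- ln (1/2 + 1 / n)) \<le> ks_entropy T M"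
      using ks_entropy_biased_walk[of "1/2 + 1 / n"] by auto
    thus ?thesis by (intro SUP_upper2[of M]) auto
  qed
  have "(\<lambda>n. - ln (1/2 + 1 / real n)) \<longlonglongrightarrow> - ln (1/2 + 0)"
    by (intro tendsto_intros lim_const_over_n) auto
  hence "(\<lambda>n. ereal (- ln (1/2 + 1 / real n))) \<longlonglongrightarrow> ereal (ln 2)" by (simp add: ln_div)
  thus ?thesis
    by (rule tendsto_upperbound) (auto simp: eventually_sequentially intro!: exI[of _ 3] le)
qed

end

section \<open>Null recurrence and approximation of partitions\<close>

text \<open>Words compatible with a final height of at least \<open>(1/2) ^ K\<close>, peeled from
  their last letter: \<open>True\<close> requires at least \<open>(1/2) ^ (K + 1)\<close> before it,
  \<open>False\<close> requires twice \<open>(1/2) ^ K\<close>, which is impossible for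
  \<open>K = 0\<close> because heights never exceed 1.\<close>

fun backward_walks :: "nat \<Rightarrow> nat \<Rightarrow> bool list set" where
  "backward_walks 0 K = {[]}"
| "backward_walks (Suc n) K = (\<lambda>w. w @ [True]) ` backward_walks n (K + 1) \<union>
     (if K = 0 then {} else (\<lambda>w. w @ [False]) ` backward_walks n (K - 1))"

lemma finite_backward_walks [simp]: "finite (backward_walks n K)"
  by (induction n arbitrary: K) auto

lemma length_backward_walks: "w \<in> backward_walks n K \<Longrightarrow> length w = n"
  by (induction n arbitrary: K w) (auto split: if_splits)

lemma card_backward_walks_Suc:
  "card (backward_walks (Suc n) K)
   = card (backward_walks n (K + 1)) + (if K = 0 then 0 else card (backward_walks n (K - 1)))"
proof -
  have inj: "inj_on (\<lambda>w. w @ [b]) S" for b :: bool and S by (auto simp: inj_on_def)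
  show ?thesis
    by (simp, subst card_Un_disjoint) (auto simp: card_image[OF inj])
qed

text \<open>The limiting density of surviving walks is a bounded harmonic function of the starting level
  vanishing at level \<open>-1\<close>, hence zero.\<close>
lemma backward_walks_density:
  "(\<lambda>n. card (backward_walks n K) / 2 ^ n) \<longlonglongrightarrow> 0"
proof -
  define a where "a n K = card (backward_walks n K) / 2 ^ n" for n K
  have a0: "a n K \<ge> 0" for n K by (simp add: a_def)
  have rec: "a (Suc n) K = (a n (K + 1) + (if K = 0 then 0 else a n (K - 1))) / 2" for n K
    unfolding a_def card_backward_walks_Suc by (simp add: add_divide_distrib)
  have dec: "a (Suc n) K \<le> a n K" for n K
  proof (induction n arbitrary: K)
    case 0
    show ?case using rec[of 0 K] by (simp add: a_def)
  next
    case (Suc n)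
    show ?case unfolding rec[of "Suc n" K] rec[of n K]
      using Suc by (intro divide_right_mono add_mono) auto
  qed
  have le1: "a n K \<le> 1" for n K
  proof (induction n)
    case 0
    show ?case by (simp add: a_def)
  next
    case (Suc n)
    thus ?case using dec[of n K] by linarith
  qed
  have "\<exists>l. (\<lambda>n. a n K) \<longlonglongrightarrow> l" for K
  proof -
    have "decseq (\<lambda>n. a n K)" using dec by (rule decseq_SucI)
    thus ?thesis using decseq_convergent[of "\<lambda>n. a n K" 0] a0 by metis
  qed
  then obtain L where L: "\<And>K. (\<lambda>n. a n K) \<longlonglongrightarrow> L K" by metis
  have L01: "0 \<le> L K" "L K \<le> 1" for K
    using LIMSEQ_le_const[OF L[of K], of 0] LIMSEQ_le_const2[OF L[of K], of 1] a0 le1 by auto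
  have Lrec: "L K = (L (K + 1) + (if K = 0 then 0 else L (K - 1))) / 2" for K
  proof (rule LIMSEQ_unique)
    show "(\<lambda>n. a (Suc n) K) \<longlonglongrightarrow> L K" using L by (rule LIMSEQ_Suc)
    show "(\<lambda>n. a (Suc n) K) \<longlonglongrightarrow> (L (K + 1) + (if K = 0 then 0 else L (K - 1))) / 2"
      unfolding rec using L by (auto intro!: tendsto_intros)
  qed
  \<comment> \<open>The recursion says that second differences vanish, with value 0 at the virtual
    level -1, so \<open>L\<close> is linear with slope \<open>L 0\<close>; boundedness then forces
    the slope to be 0.\<close>
  have lin: "L K = (K + 1) * L 0 \<and> L (Suc K) = (K + 2) * L 0" for K
  proof (induction K)
    case 0
    show ?case using Lrec[of 0] by simp
  next
    case (Suc K)
    thus ?case using Lrec[of "Suc K"] by (simp add: algebra_simps)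
  qed
  have "L 0 = 0"
  proof (rule ccontr)
    assume "L 0 \<noteq> 0"
    hence pos: "L 0 > 0" using L01(1)[of 0] by linarith
    obtain K :: nat where "real K > 1 / L 0" using reals_Archimedean2 by blast
    hence "real K * L 0 > 1" using pos by (simp add: field_simps)
    moreover have "real K * L 0 \<le> L K" using lin[of K] pos by (simp add: algebra_simps)
    ultimately show False using L01(2)[of K] by linarith
  qed
  hence "L K = 0" using lin[of K] by simp
  thus ?thesis using L[of K] by (simp add: a_def)
qed

text \<open>Both come from \<open>ln x \<le> x - 1\<close>, taken at \<open>1 / q\<close> and at
  \<open>1 / sqrt q\<close>. The first is sharp for \<open>q\<close> near 1, the second controls
  small \<open>q\<close>.\<close>

lemma neg_mult_ln_le:
  fixes q :: real
  assumes "0 \<le> q"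
  shows "- (q * ln q) \<le> 1 - q" "- (q * ln q) \<le> 2 * sqrt q"
proof -
  show "- (q * ln q) \<le> 1 - q"
  proof (cases "q = 0")
    case False
    hence q: "q > 0" using assms by simp
    have "ln (1 / q) \<le> 1 / q - 1" using q by (intro ln_le_minus_one) auto
    hence "q * ln (1 / q) \<le> q * (1 / q - 1)" using q by (intro mult_left_mono) auto
    thus ?thesis using q by (simp add: ln_div algebra_simps)
  qed simp
  show "- (q * ln q) \<le> 2 * sqrt q"
  proof (cases "q = 0")
    case False
    hence q: "q > 0" using assms by simp
    have "ln (1 / sqrt q) \<le> 1 / sqrt q - 1" using q by (intro ln_le_minus_one) auto
    hence "- ln q \<le> 2 * (1 / sqrt q)" using q by (simp add: ln_div ln_sqrt)
    hence "q * (- ln q) \<le> q * (2 * (1 / sqrt q))" using q by (intro mult_left_mono) auto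
    also have "q * (2 * (1 / sqrt q)) = 2 * (q / sqrt q)" by simp
    also have "q / sqrt q = sqrt q" using q by (intro real_div_sqrt) simp
    finally show ?thesis by simp
  qed simp
qed

text \<open>The label \<open>None\<close> has mass at least \<open>1 - \<delta>\<close> and
  contributes at most \<open>\<delta>\<close>; each of the remaining labels has mass at most
  \<open>\<delta>\<close> and contributes at most \<open>2 * sqrt \<delta>\<close>.\<close>

lemma (in prob_space) label_entropy_option_le:
  assumes e: "simple_function M e" and P: "finite P" "e ` space M \<subseteq> insert None (Some ` P)"
    and small: "prob {x \<in> space M. e x \<noteq> None} \<le> \<delta>"
  shows "label_entropy M e \<le> \<delta> + card P * (2 * sqrt \<delta>)"
proof -
  define q where "q y = prob (e -` {y} \<inter> space M)" for y
  have sets: "e -` {y} \<inter> space M \<in> sets M" for y using e by (rule simple_functionD)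
  have ne: "{x \<in> space M. e x \<noteq> None} = space M - (e -` {None} \<inter> space M)" by auto
  have neset: "{x \<in> space M. e x \<noteq> None} \<in> sets M" unfolding ne using sets by auto
  have "1 - q None \<le> \<delta>"
    using small unfolding ne by (subst (asm) prob_compl[OF sets]) (simp add: q_def)
  hence n: "- (q None * ln (q None)) \<le> \<delta>"
    using neg_mult_ln_le(1)[of "q None"] by (simp add: q_def)
  have s: "- (q (Some A) * ln (q (Some A))) \<le> 2 * sqrt \<delta>" for A
  proof -
    have "q (Some A) \<le> prob {x \<in> space M. e x \<noteq> None}"
      unfolding q_def by (rule finite_measure_mono[OF _ neset]) auto
    hence "sqrt (q (Some A)) \<le> sqrt \<delta>" using small by simp
    moreover have "0 \<le> q (Some A)" by (simp add: q_def)
    ultimately show ?thesis using neg_mult_ln_le(2)[of "q (Some A)"] by linarith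
  qed
  have "label_entropy M e = - (\<Sum>y\<in>insert None (Some ` P). q y * ln (q y))"
    unfolding q_def by (rule label_entropy_superset) (use P in auto)
  also have "\<dots> = - (q None * ln (q None)) + (\<Sum>A\<in>P. - (q (Some A) * ln (q (Some A))))"
    using P by (simp add: sum.reindex sum_negf)
  also have "\<dots> \<le> \<delta> + (\<Sum>A\<in>P. 2 * sqrt \<delta>)"
    using n s by (intro add_mono sum_mono) auto
  finally show ?thesis by simp
qed

lemma uniform_separation:
  fixes K :: "'b \<Rightarrow> 'a::heine_borel set"
  assumes "finite P" "\<And>A. A \<in> P \<Longrightarrow> compact (K A)"
    and disj: "\<And>A B. A \<in> P \<Longrightarrow> B \<in> P \<Longrightarrow> A \<noteq> B \<Longrightarrow> K A \<inter> K B = {}"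
  shows "\<exists>d>0. \<forall>A\<in>P. \<forall>B\<in>P. A \<noteq> B \<longrightarrow> (\<forall>x\<in>K A. \<forall>y\<in>K B. d \<le> dist x y)"
proof -
  define Q where "Q = {(A, B). A \<in> P \<and> B \<in> P \<and> A \<noteq> B}"
  have "Q \<subseteq> P \<times> P" by (auto simp: Q_def)
  hence Q: "finite Q" using assms(1) finite_subset by blast
  have "\<forall>q\<in>Q. \<exists>d>0. \<forall>x\<in>K (fst q). \<forall>y\<in>K (snd q). d \<le> dist x y"
  proof
    fix q assume "q \<in> Q"
    thus "\<exists>d>0. \<forall>x\<in>K (fst q). \<forall>y\<in>K (snd q). d \<le> dist x y"
      using separate_compact_closed[of "K (fst q)" "K (snd q)"] assms(2) disj
      by (auto simp: Q_def compact_imp_closed)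
  qed
  then obtain D where D: "\<And>q. q \<in> Q \<Longrightarrow> D q > 0"
    "\<And>q x y. q \<in> Q \<Longrightarrow> x \<in> K (fst q) \<Longrightarrow> y \<in> K (snd q) \<Longrightarrow> D q \<le> dist x y"
    by (metis bchoice)
  \<comment> \<open>Inserting 1 keeps the minimum meaningful when there are no pairs.\<close>
  define d where "d = Min (insert 1 (D ` Q))"
  have "d > 0" unfolding d_def using Q D(1) by (subst Min_gr_iff) auto
  moreover have "d \<le> dist x y" if "A \<in> P" "B \<in> P" "A \<noteq> B" "x \<in> K A" "y \<in> K B" for A B x y
  proof -
    have q: "(A, B) \<in> Q" using that by (auto simp: Q_def)
    hence "d \<le> D (A, B)" unfolding d_def using Q by (intro Min_le) auto
    also have "\<dots> \<le> dist x y" using D(2)[OF q] that by simp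
    finally show ?thesis .
  qed
  ultimately show ?thesis by blast
qed

text \<open>\<open>inner_regular\<close> speaks of Borel measures on the whole space, so
  \<open>M\<close> is first pushed forward along the inclusion of \<open>X\<close>.\<close>

lemma compact_inner_approximation:
  fixes M :: "'a::{second_countable_topology, complete_space} measure"
  assumes "prob_space M" and sets: "sets M = sets (restrict_space borel X)" and X: "X \<in> sets borel"
    and A: "A \<in> sets M" and "\<delta> > 0"
  obtains K where "compact K" "K \<subseteq> A" "K \<in> sets M" "measure M (A - K) \<le> \<delta>"
proof -
  interpret prob_space M by fact
  have AX: "A \<subseteq> X" "A \<in> sets borel"
    using A X by (auto simp: sets sets_restrict_space_iff)
  have id: "(\<lambda>x. x) \<in> M \<rightarrow>\<^sub>M borel"
    using measurable_restrict_space1[OF measurable_ident, of borel X]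
    by (subst measurable_cong_sets[OF sets refl]) (simp add: id_def)
  define N where "N = distr M borel (\<lambda>x. x)"
  have space: "space M = X" using sets_eq_imp_space_eq[OF sets] by (simp add: space_restrict_space)
  have N: "emeasure N B = prob B" if "B \<subseteq> A" "B \<in> sets borel" for B
  proof -
    have "emeasure N B = emeasure M ((\<lambda>x. x) -` B \<inter> space M)"
      unfolding N_def using id that by (intro emeasure_distr) auto
    also have "(\<lambda>x. x) -` B \<inter> space M = B" using that AX space by auto
    finally show ?thesis by (simp add: emeasure_eq_measure)
  qed
  have SUP: "emeasure N A = (SUP K \<in> {K. K \<subseteq> A \<and> compact K}. emeasure N K)"
  proof (rule inner_regular)
    show "emeasure N (space N) \<noteq> \<infinity>"
      using prob_space.emeasure_space_1[OF prob_space_distr[OF id]] by (simp add: N_def)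
  qed (use AX in \<open>auto simp: N_def\<close>)
  show thesis
  \<comment> \<open>The split keeps \<open>prob A - \<delta>\<close> nonnegative, as
    \<open>ennreal\<close> would truncate it at 0.\<close>
  proof (cases "prob A \<le> \<delta>")
    case True
    thus thesis using that[of "{}"] by auto
  next
    case False
    have "ennreal (prob A - \<delta>) < emeasure N A"
      using N[of A] AX False \<open>\<delta> > 0\<close> by (simp add: ennreal_less_iff)
    then obtain K where K: "K \<subseteq> A" "compact K" "ennreal (prob A - \<delta>) < emeasure N K"
      unfolding SUP less_SUP_iff by blast
    have Kb: "K \<in> sets borel" using K(2) by (simp add: borel_compact)
    hence "ennreal (prob A - \<delta>) < ennreal (prob K)" using K N by simp
    hence "prob A - \<delta> < prob K" using False by (subst (asm) ennreal_less_iff) auto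
    moreover have KM: "K \<in> sets M" unfolding sets using Kb K AX X by (subst sets_restrict_space_iff) auto
    ultimately have "prob (A - K) \<le> \<delta>" using K(1) A by (subst finite_measure_Diff) auto
    thus thesis using that K KM by blast
  qed
qed

section \<open>Symbols and heights under an invariant measure\<close>

locale invariant_cone_measure = cone_map i j for i j :: "'n::finite" +
  fixes M :: "(real ^ 'n) measure"
  assumes M: "M \<in> invariant_measures T unit_cube"
begin

sublocale invariant_system M T
  by (rule invariant_system_of_invariant_measure[OF M])

lemma space_M: "space M = unit_cube"
  by (rule space_invariant_measure[OF M])

lemma sets_M: "sets M = sets (restrict_space borel unit_cube)"
  using M by (simp add: invariant_measures_def)

lemma irregular_sets: "{p \<in> unit_cube. \<not> regular p} \<in> sets M"
proof -
  have "{p \<in> unit_cube. regular p} \<in> sets M" unfolding sets_M by (rule measurable_regular)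
  moreover have "{p \<in> unit_cube. \<not> regular p} = space M - {p \<in> unit_cube. regular p}"
    unfolding space_M by blast
  ultimately show ?thesis by (simp only: sets.compl_sets)
qed

text \<open>The irregular set is wandering.\<close>
lemma prob_irregular: "prob {p \<in> unit_cube. \<not> regular p} = 0"
proof (rule ccontr)
  define B where "B = {p \<in> unit_cube. \<not> regular p}"
  assume "prob {p \<in> unit_cube. \<not> regular p} \<noteq> 0"
  hence pos: "prob B > 0" by (simp add: B_def zero_less_measure_iff)
  have B: "B \<in> sets M" unfolding B_def by (rule irregular_sets)
  \<comment> \<open>From two steps after an irregular point the orbit is on the axis, where points
    are regular. Spacing the times by 2 therefore makes the preimages disjoint, and by invariance
    they have equal mass.\<close>
  define E where "E a = (T ^^ (2 * a)) -` B \<inter> space M" for a :: nat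
  have E: "E a \<in> sets M" for a unfolding E_def by (rule measurable_sets[OF measurable_funpow B])
  have empty: "E a \<inter> E b = {}" if "a < b" for a b
  proof -
    have False if x: "x \<in> space M" "(T ^^ (2 * a)) x \<in> B" "(T ^^ (2 * b)) x \<in> B" for x
    proof -
      obtain c where c: "2 * b = c + 2 * a" "c \<ge> 2" using \<open>a < b\<close> that by (intro that[of "2 * b - 2 * a"]) auto
      have "(T ^^ (2 * b)) x = (T ^^ c) ((T ^^ (2 * a)) x)" unfolding c(1) by (simp add: funpow_add)
      hence "(T ^^ (2 * b)) x $ i = 0" using funpow_T_irregular[OF _ _ c(2)] x(2) by (auto simp: B_def)
      hence "regular ((T ^^ (2 * b)) x)" using T_axis(3) x(3) by (auto simp: B_def)
      thus False using x(3) by (simp add: B_def)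
    qed
    thus ?thesis unfolding E_def by auto
  qed
  have disj: "disjoint_family_on E {..<N}" for N
    unfolding disjoint_family_on_def using empty by (metis Int_commute nat_neq_iff)
  obtain N :: nat where N: "real N > 1 / prob B" using reals_Archimedean2 by blast
  have "real N * prob B = (\<Sum>a<N. prob (E a))"
    unfolding E_def prob_funpow_vimage[OF B] by simp
  also have "\<dots> = prob (\<Union>a<N. E a)"
    using E disj by (intro finite_measure_finite_Union[symmetric]) auto
  also have "\<dots> \<le> 1" by (rule prob_le_1)
  finally show False using N pos by (simp add: field_simps)
qed

definition coded :: "(real ^ 'n) set" where
  "coded = {p \<in> unit_cube. (\<forall>k. regular ((T ^^ k) p)) \<and> (\<forall>k. k \<noteq> i \<longrightarrow> k \<noteq> j \<longrightarrow> p $ k = 0)}"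

text \<open>Each time excludes one null set, the preimage of the irregular points. The plane of the
  two active coordinates contains the image of \<open>T\<close>, so invariance gives it full
  mass.\<close>

lemma AE_coded: "AE p in M. p \<in> coded"
proof -
  have "AE p in M. p \<in> space M" by (rule AE_space)
  moreover have "AE p in M. \<forall>k. regular ((T ^^ k) p)"
    unfolding AE_all_countable
  proof
    fix k
    have "AE p in M. p \<notin> {p \<in> unit_cube. \<not> regular p}"
      using prob_irregular irregular_sets by (subst (asm) prob_eq_0) auto
    hence "AE p in M. regular p" using AE_space
      by eventually_elim (simp add: space_M del: mem_box_cart)
    thus "AE p in M. regular ((T ^^ k) p)" by (rule AE_funpow)
  qed
  moreover have "AE p in M. \<forall>k. k \<noteq> i \<longrightarrow> k \<noteq> j \<longrightarrow> p $ k = 0"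
  proof -
    let ?A = "{p \<in> unit_cube. \<forall>k. k \<noteq> i \<longrightarrow> k \<noteq> j \<longrightarrow> p $ k = 0}"
    have A: "?A \<in> sets M" unfolding sets_M by (rule measurable_plane)
    have "prob ?A = prob ((T ^^ 1) -` ?A \<inter> space M)" by (rule prob_funpow_vimage[OF A, symmetric])
    also have "(T ^^ 1) -` ?A \<inter> space M = space M"
      using T_in_cube by (auto simp: space_M T_other simp del: mem_box_cart)
    finally have "prob ?A = 1" by (simp add: prob_space)
    hence "AE p in M. p \<in> ?A" using A by (simp add: prob_eq_1)
    thus ?thesis by (auto elim: eventually_mono)
  qed
  ultimately show ?thesis
    by eventually_elim (simp add: coded_def space_M)
qed

lemma simple_function_upper: "simple_function M upper"
proof -
  have up: "{p \<in> unit_cube. upper p} \<in> sets M" unfolding sets_M by (rule measurable_upper)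
  have "upper -` {True} \<inter> space M = {p \<in> unit_cube. upper p}"
    "upper -` {False} \<inter> space M = space M - {p \<in> unit_cube. upper p}" by (auto simp: space_M)
  hence "upper -` {b} \<inter> space M \<in> sets M" for b
    using up sets.compl_sets[OF up] by (cases b) simp_all
  thus ?thesis by (auto simp: simple_function_def)
qed

lemma simple_function_height_cell: "simple_function M (height_cell J)"
proof -
  have "height_cell J -` {y} \<inter> space M = {p \<in> unit_cube. height_cell J p = y}" for y
    by (auto simp: space_M)
  hence "height_cell J -` {y} \<inter> space M \<in> sets M" for y
    using measurable_height_cell sets_M by simp
  moreover have "height_cell J ` space M \<subseteq> {..J}"
    unfolding space_M using height_cell_le by blast
  hence "finite (height_cell J ` space M)" by (rule finite_subset) simp
  ultimately show ?thesis unfolding simple_function_def by blast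
qed

definition cell_label :: "nat \<Rightarrow> real ^ 'n \<Rightarrow> bool \<times> nat" where
  "cell_label J p = (upper p, height_cell J p)"

lemma simple_function_cell_label: "simple_function M (cell_label J)"
  unfolding cell_label_def[abs_def]
  by (rule simple_function_Pair[OF simple_function_upper simple_function_height_cell])

text \<open>Given the symbols, the sum of the \<open>n\<close> height indices determines all of them
  by \<open>height_cells_determined\<close>, and this sum has at most \<open>n * J + 1\<close>
  values. Heights thus cost only a logarithm.\<close>

lemma label_entropy_cells_le:
  "label_entropy M (itinerary T (cell_label J) n)
     \<le> label_entropy M (itinerary T upper n) + ln (real (n * J + 1))"
proof -
  define r where "r p = (\<Sum>k<n. height_cell J ((T ^^ k) p))" for p
  note it = simple_function_itinerary
  have "r = (\<lambda>p. sum_list (itinerary T (height_cell J) n p))"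
    by (simp add: fun_eq_iff r_def itinerary_def interv_sum_list_conv_sum_set_nat atLeast0LessThan)
  hence r: "simple_function M r"
    using simple_function_compose1[OF it[OF simple_function_height_cell], where g = sum_list]
    by (simp only:)
  have "r ` space M \<subseteq> {..n * J}"
  proof
    fix y assume "y \<in> r ` space M"
    then obtain p where p: "p \<in> unit_cube" "y = r p" by (auto simp: space_M)
    have "r p \<le> (\<Sum>k<n. J)" unfolding r_def using funpow_T_in_cube[OF p(1)] height_cell_le by (intro sum_mono) auto
    thus "y \<in> {..n * J}" using p by simp
  qed
  hence Hr: "label_entropy M r \<le> ln (real (n * J + 1))"
    using label_entropy_le_card[OF r, of "{..n * J}"] by simp
  have "label_entropy M (itinerary T (cell_label J) n) \<le> label_entropy M (\<lambda>p. (itinerary T upper n p, r p))"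
  proof (rule label_entropy_le_of_determined[OF _ it[OF simple_function_cell_label] AE_coded])
    show "simple_function M (\<lambda>p. (itinerary T upper n p, r p))"
      by (rule simple_function_Pair[OF it[OF simple_function_upper] r])
    fix p q assume p: "p \<in> coded" and q: "q \<in> coded"
      and "(itinerary T upper n p, r p) = (itinerary T upper n q, r q)"
    hence up: "\<forall>k<n. upper ((T ^^ k) p) = upper ((T ^^ k) q)" and s: "r p = r q"
      by (auto simp: itinerary_eq_iff)
    have "height_cell J ((T ^^ k) p) = height_cell J ((T ^^ k) q)" if "k < n" for k
      by (rule height_cells_determined[of p q "{..<n}" n])
        (use p q up s that in \<open>auto simp: coded_def r_def\<close>)
    thus "itinerary T (cell_label J) n p = itinerary T (cell_label J) n q"
      using up by (auto simp: itinerary_eq_iff cell_label_def)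
  qed
  also have "\<dots> \<le> label_entropy M (itinerary T upper n) + label_entropy M r"
    by (rule label_entropy_Pair_le[OF it[OF simple_function_upper] r])
  finally show ?thesis using Hr by linarith
qed

text \<open>Contraction leaves \<open>2 / J + (1/4) ^ n\<close> for the position and the height cell
  at time 0 gives \<open>1 / J\<close>; all other coordinates of coded points vanish.\<close>

lemma coded_close:
  assumes "p \<in> coded" "q \<in> coded" "J > 0" "n > 0"
    and eq: "itinerary T (cell_label J) n p = itinerary T (cell_label J) n q"
  shows "dist p q \<le> 3 / J + (1/4) ^ n"
proof -
  have cube: "p \<in> unit_cube" "q \<in> unit_cube" using assms by (auto simp: coded_def)
  have up: "\<forall>k<n. upper ((T ^^ k) p) = upper ((T ^^ k) q)"
    and cells: "\<forall>k<n. height_cell J ((T ^^ k) p) = height_cell J ((T ^^ k) q)"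
    using eq by (auto simp: itinerary_eq_iff cell_label_def)
  have h: "\<bar>(T ^^ k) p $ j - (T ^^ k) q $ j\<bar> \<le> 1 / J" if "k < n" for k
    using cells that funpow_T_in_cube cube \<open>J > 0\<close> by (intro height_cell_close) auto
  have "\<bar>p $ i - q $ i\<bar> \<le> 2 * (1 / J) + \<bar>(T ^^ n) p $ i - (T ^^ n) q $ i\<bar> / 4 ^ n"
    by (rule position_contraction[OF cube]) (use up h assms(1,2) in \<open>auto simp: coded_def\<close>)
  also have "\<bar>(T ^^ n) p $ i - (T ^^ n) q $ i\<bar> / 4 ^ n \<le> 1 / 4 ^ n"
    using cubeD[OF funpow_T_in_cube[OF cube(1)], of n i] cubeD[OF funpow_T_in_cube[OF cube(2)], of n i]
    by (intro divide_right_mono) auto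
  finally have "\<bar>p $ i - q $ i\<bar> \<le> 2 * (1 / J) + (1/4) ^ n" by (simp add: power_one_over)
  moreover have "\<bar>p $ j - q $ j\<bar> \<le> 1 / J" using h[of 0] \<open>n > 0\<close> by simp
  moreover have "dist p q \<le> \<bar>p $ i - q $ i\<bar> + \<bar>p $ j - q $ j\<bar>"
    by (rule dist_le_coords) (use assms(1,2) in \<open>auto simp: coded_def\<close>)
  ultimately show ?thesis by simp
qed

lemma label_entropy_upper_le: "label_entropy M (itinerary T upper n) \<le> n * ln 2"
proof -
  have "label_entropy M upper \<le> ln (card (UNIV :: bool set))"
    by (rule label_entropy_le_card[OF simple_function_upper]) auto
  hence "n * label_entropy M upper \<le> n * ln 2" by (intro mult_left_mono) (auto simp: card_UNIV_bool)
  thus ?thesis using label_entropy_itinerary_le[OF simple_function_upper, of n] by linarith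
qed

lemma height_in_backward_walks:
  assumes "p \<in> coded" "(1/2) ^ K \<le> (T ^^ n) p $ j"
  shows "itinerary T upper n p \<in> backward_walks n K"
  using assms(2)
proof (induction n arbitrary: K)
  case (Suc n)
  let ?q = "(T ^^ n) p"
  have q: "?q \<in> unit_cube" "regular ?q" using assms(1) funpow_T_in_cube by (auto simp: coded_def)
  show ?case
  proof (cases "upper ?q")
    case True
    hence "(1/2) ^ (K + 1) \<le> ?q $ j" using Suc.prems T_upper(2)[OF q] by simp
    thus ?thesis using Suc.IH[of "K + 1"] True by (simp add: itinerary_Suc)
  next
    case False
    hence le: "2 * (1/2) ^ K \<le> ?q $ j" using Suc.prems T_lower(2)[OF q] by simp
    moreover have "?q $ j \<le> 1" using cubeD q by blast
    ultimately have "K \<noteq> 0" by (cases K) auto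
    moreover from this have "(1/2) ^ (K - 1) \<le> ?q $ j" using le by (cases K) auto
    ultimately show ?thesis using Suc.IH[of "K - 1"] False by (simp add: itinerary_Suc)
  qed
qed simp

text \<open>Otherwise all coin words of each length are equally likely, which makes every positive
  height improbable. At height 0 only one symbol occurs, contrary to uniformity for words of length
  1.\<close>

lemma ex_label_entropy_upper_less:
  "\<exists>m>0. label_entropy M (itinerary T upper m) < m * ln 2"
proof (rule ccontr)
  assume "\<not> ?thesis"
  hence max: "label_entropy M (itinerary T upper m) = m * ln 2" if "m > 0" for m
    using \<open>\<not> (\<exists>m>0. label_entropy M (itinerary T upper m) < m * ln 2)\<close> that
      label_entropy_upper_le[of m] by (meson antisym_conv not_less)
  have unif: "prob (itinerary T upper m -` {w} \<inter> space M) = 1 / 2 ^ m"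
    if "m > 0" "length w = m" for m w
  proof -
    let ?S = "{w :: bool list. length w = m}"
    have S: "finite ?S" "card ?S = 2 ^ m"
      using finite_lists_length_eq[of "UNIV :: bool set" m] card_lists_length_eq[of "UNIV :: bool set" m]
      by (auto simp: card_UNIV_bool)
    have "prob (itinerary T upper m -` {w} \<inter> space M) = 1 / card ?S"
      by (rule label_entropy_eq_card[OF simple_function_itinerary[OF simple_function_upper]])
        (use S that max in \<open>auto simp: ln_realpow\<close>)
    thus ?thesis using S by simp
  qed
  \<comment> \<open>Invariance moves the event to time \<open>n\<close>, where the preceding
    \<open>n\<close> coins must form a word in \<open>backward_walks n K\<close>. Uniformity bounds
    its mass by the density of these words, which tends to 0.\<close>
  have "prob {p \<in> unit_cube. (1/2) ^ K \<le> p $ j} = 0" for K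
  proof -
    let ?A = "{p \<in> unit_cube. (1/2) ^ K \<le> p $ j}"
    have A: "?A \<in> sets M" unfolding sets_M by (rule measurable_height)
    have le: "prob ?A \<le> card (backward_walks n K) / 2 ^ n" if "n > 0" for n
    proof -
      let ?C = "\<lambda>w. itinerary T upper n -` {w} \<inter> space M"
      have C: "?C w \<in> sets M" for w
        using simple_function_itinerary[OF simple_function_upper] by (rule simple_functionD)
      have "prob ?A = prob ((T ^^ n) -` ?A \<inter> space M)" by (rule prob_funpow_vimage[OF A, symmetric])
      also have "\<dots> \<le> prob (\<Union>w\<in>backward_walks n K. ?C w)"
      proof (rule finite_measure_mono_AE)
        show "AE p in M. p \<in> (T ^^ n) -` ?A \<inter> space M \<longrightarrow> p \<in> (\<Union>w\<in>backward_walks n K. ?C w)"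
          using AE_coded by eventually_elim (use height_in_backward_walks in auto)
        show "(\<Union>w\<in>backward_walks n K. ?C w) \<in> sets M"
          by (intro sets.finite_UN finite_backward_walks C)
      qed
      also have "\<dots> \<le> (\<Sum>w\<in>backward_walks n K. prob (?C w))"
        using C by (intro finite_measure_subadditive_finite) auto
      also have "\<dots> = (\<Sum>w\<in>backward_walks n K. 1 / 2 ^ n)"
        using unif[OF that] length_backward_walks by (intro sum.cong) auto
      finally show ?thesis by simp
    qed
    have "prob ?A \<le> 0"
      by (rule LIMSEQ_le_const[OF backward_walks_density[of K]]) (use le in \<open>auto intro!: exI[of _ 1]\<close>)
    thus ?thesis using measure_nonneg[of M ?A] by linarith
  qed
  hence "AE p in M. \<not> (1/2) ^ K \<le> p $ j" for K :: nat
  proof -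
    have "{p \<in> unit_cube. (1/2) ^ K \<le> p $ j} \<in> sets M" unfolding sets_M by (rule measurable_height)
    thus ?thesis using \<open>\<And>K. prob {p \<in> unit_cube. (1/2) ^ K \<le> p $ j} = 0\<close>
      by (intro AE_I[of _ _ "{p \<in> unit_cube. (1/2) ^ K \<le> p $ j}"]) (auto simp: space_M emeasure_eq_measure)
  qed
  hence "AE p in M. \<forall>K::nat. \<not> (1/2) ^ K \<le> p $ j" by (simp add: AE_all_countable)
  \<comment> \<open>With height 0 the inequality defining \<open>upper\<close> reads
    \<open>0 \<le> p $ i\<close>.\<close>
  hence "AE p in M. upper p" using AE_space
  proof eventually_elim
    case (elim p)
    hence p: "p \<in> unit_cube" by (simp add: space_M)
    have "p $ j \<le> 0"
    proof (rule ccontr)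
      assume "\<not> p $ j \<le> 0"
      then obtain K where "(1/2) ^ K < p $ j" using real_arch_pow_inv[of "p $ j" "1/2"] by auto
      thus False using elim(1) by (meson less_imp_le)
    qed
    thus ?case using cubeD(1)[OF p, of i] by (simp add: upper_def)
  qed
  hence "AE p in M. p \<notin> itinerary T upper 1 -` {[False]} \<inter> space M"
    by eventually_elim (simp add: itinerary_Suc)
  hence "prob (itinerary T upper 1 -` {[False]} \<inter> space M) = 0"
    using simple_functionD(2)[OF simple_function_itinerary[OF simple_function_upper]]
    by (subst prob_eq_0) auto
  thus False using unif[of 1 "[False]"] by simp
qed

end

section \<open>Strict upper bound for the measure entropy\<close>

context invariant_cone_measure begin

text \<open>Every finite partition is, up to an error label of small entropy, a function of finitely many
  cell labels: approximate its members by compact sets, which small cells separate.\<close>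
lemma approximate_by_cells:
  assumes P: "measurable_partition M P" and "\<eta> > 0"
  obtains J l :: nat and G where "J > 0"
    "label_entropy M (\<lambda>p. if cell_of P p = G (itinerary T (cell_label J) l p) then None else Some (cell_of P p)) \<le> \<eta>"
proof -
  have fin: "finite P" and PM: "P \<subseteq> sets M" and part: "partition_on (space M) P"
    using P by (auto simp: measurable_partition_def)
  have "P \<noteq> {}" using part not_empty by (auto simp: partition_on_def)
  define N where "N = real (card P)"
  have N: "N > 0" using fin \<open>P \<noteq> {}\<close> by (simp add: N_def card_gt_0_iff)
  \<comment> \<open>With \<open>\<delta> = s * s\<close> the square root in the entropy of the error
    label is \<open>s\<close> itself, and the total is at most
    \<open>(2 * N + 1) * s \<le> \<eta>\<close>.\<close>
  define s where "s = min 1 (\<eta> / (2 * N + 1))"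
  have s: "0 < s" "s \<le> 1" "(2 * N + 1) * s \<le> \<eta>"
  proof -
    show "0 < s" "s \<le> 1" using N \<open>\<eta> > 0\<close> by (auto simp: s_def)
    have "s \<le> \<eta> / (2 * N + 1)" by (simp add: s_def)
    thus "(2 * N + 1) * s \<le> \<eta>" using N by (simp add: pos_le_divide_eq mult.commute)
  qed
  define \<delta> where "\<delta> = s * s"
  have \<delta>: "\<delta> > 0" "\<delta> + N * (2 * sqrt \<delta>) \<le> \<eta>"
  proof -
    show "\<delta> > 0" using s by (simp add: \<delta>_def)
    have "\<delta> \<le> s" unfolding \<delta>_def using s mult_left_mono[of s 1 s] by simp
    moreover have "sqrt \<delta> = s" unfolding \<delta>_def using s by simp
    ultimately show "\<delta> + N * (2 * sqrt \<delta>) \<le> \<eta>" using s(3) by (simp add: algebra_simps)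
  qed
  have "\<forall>A\<in>P. \<exists>K. compact K \<and> K \<subseteq> A \<and> K \<in> sets M \<and> prob (A - K) \<le> \<delta> / N"
  proof
    fix A assume "A \<in> P"
    hence "A \<in> sets M" using PM by auto
    moreover have "\<delta> / N > 0" using \<delta> N by simp
    moreover have "(unit_cube :: (real ^ 'n) set) \<in> sets borel" by (intro borel_closed closed_cbox)
    ultimately show "\<exists>K. compact K \<and> K \<subseteq> A \<and> K \<in> sets M \<and> prob (A - K) \<le> \<delta> / N"
      using compact_inner_approximation[OF prob_space_axioms sets_M, of A "\<delta> / N"] by blast
  qed
  then obtain K where K: "\<And>A. A \<in> P \<Longrightarrow> compact (K A)" "\<And>A. A \<in> P \<Longrightarrow> K A \<subseteq> A"
    "\<And>A. A \<in> P \<Longrightarrow> K A \<in> sets M" "\<And>A. A \<in> P \<Longrightarrow> prob (A - K A) \<le> \<delta> / N"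
    by (metis bchoice)
  have disj: "K A \<inter> K B = {}" if "A \<in> P" "B \<in> P" "A \<noteq> B" for A B
    using that K(2) part unfolding partition_on_def disjoint_def by blast
  obtain d where d0: "d > 0"
    and sep: "\<forall>A\<in>P. \<forall>B\<in>P. A \<noteq> B \<longrightarrow> (\<forall>x\<in>K A. \<forall>y\<in>K B. d \<le> dist x y)"
    using uniform_separation[of P K, OF fin K(1) disj] by fast
  \<comment> \<open>The distance bound of \<open>coded_close\<close> is split in halves:
    \<open>3 / J < d / 2\<close>, and \<open>l\<close> is chosen so that
    \<open>(1/4) ^ l < d / 2\<close>.\<close>
  obtain J :: nat where J: "real J > 6 / d" using reals_Archimedean2 by blast
  have J0: "J > 0" using J d0 by (metis divide_pos_pos less_trans of_nat_0_less_iff zero_less_numeral)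
  have Jd: "3 / J < d / 2" using J J0 d0 by (simp add: field_simps)
  obtain l0 where l0: "(1/4::real) ^ l0 < d / 2" using real_arch_pow_inv[of "d / 2" "1/4"] d0 by auto
  define l where "l = Suc l0"
  have "(1/4::real) ^ l \<le> (1/4) ^ l0" unfolding l_def by (intro power_decreasing) auto
  hence l: "(1/4::real) ^ l < d / 2" using l0 by linarith
  have close: "dist p q < d" if "p \<in> coded" "q \<in> coded"
    "itinerary T (cell_label J) l p = itinerary T (cell_label J) l q" for p q
    using coded_close[OF that(1,2) J0 _ that(3)] Jd l by (simp add: l_def)
  \<comment> \<open>\<open>G\<close> guesses the member of \<open>P\<close> whose compact core
    contains a coded point with this word. Two cores cannot compete, since points with the same word
    are closer than \<open>d\<close>; any other wrong guess is charged to the error label.\<close>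
  define G where "G w = (SOME A. A \<in> P \<and> (\<exists>q\<in>coded \<inter> K A. itinerary T (cell_label J) l q = w))" for w
  have G: "G (itinerary T (cell_label J) l p) = A" if "A \<in> P" "p \<in> coded" "p \<in> K A" for A p
    unfolding G_def
  proof (rule some_equality)
    show "A \<in> P \<and> (\<exists>q\<in>coded \<inter> K A. itinerary T (cell_label J) l q = itinerary T (cell_label J) l p)"
      using that by blast
    fix B assume "B \<in> P \<and> (\<exists>q\<in>coded \<inter> K B. itinerary T (cell_label J) l q = itinerary T (cell_label J) l p)"
    then obtain q where q: "B \<in> P" "q \<in> coded" "q \<in> K B"
      "itinerary T (cell_label J) l q = itinerary T (cell_label J) l p" by blast
    have "dist q p < d" using close q that by metis
    moreover have "d \<le> dist q p" if "B \<noteq> A"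
      using sep q(1,3) \<open>A \<in> P\<close> \<open>p \<in> K A\<close> that by blast
    ultimately show "B = A" by fastforce
  qed
  let ?f = "cell_of P"
  let ?g = "\<lambda>p. G (itinerary T (cell_label J) l p)"
  let ?e = "\<lambda>p. if ?f p = ?g p then None else Some (?f p)"
  have f: "simple_function M ?f" by (rule simple_function_cell_of[OF P])
  have g: "simple_function M ?g"
    by (rule simple_function_compose1[OF simple_function_itinerary[OF simple_function_cell_label]])
  have e: "simple_function M ?e"
    using simple_function_compose1[OF simple_function_Pair[OF f g], where g = "\<lambda>(x, y). if x = y then None else Some x"]
    by simp
  have "label_entropy M ?e \<le> \<delta> + card P * (2 * sqrt \<delta>)"
  proof (rule label_entropy_option_le[OF e fin])
    show "?e ` space M \<subseteq> insert None (Some ` P)" using cell_of_in(1)[OF part] by auto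
    have "prob {p \<in> space M. ?e p \<noteq> None} \<le> prob (\<Union>A\<in>P. A - K A)"
    proof (rule finite_measure_mono_AE)
      show "AE p in M. p \<in> {p \<in> space M. ?e p \<noteq> None} \<longrightarrow> p \<in> (\<Union>A\<in>P. A - K A)"
        using AE_coded
      proof eventually_elim
        case (elim p)
        show ?case
        proof (rule impI)
          assume "p \<in> {p \<in> space M. ?e p \<noteq> None}"
          hence p: "p \<in> space M" "?f p \<noteq> ?g p" by (auto split: if_splits)
          have "p \<notin> K (?f p)" using G[OF cell_of_in(1)[OF part p(1)] elim] p(2) by metis
          thus "p \<in> (\<Union>A\<in>P. A - K A)" using cell_of_in[OF part p(1)] by blast
        qed
      qed
      show "(\<Union>A\<in>P. A - K A) \<in> sets M"
        using K(3) PM by (intro sets.finite_UN fin sets.Diff) auto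
    qed
    also have "\<dots> \<le> (\<Sum>A\<in>P. prob (A - K A))"
      using K(3) PM fin by (intro finite_measure_subadditive_finite) auto
    also have "\<dots> \<le> (\<Sum>A\<in>P. \<delta> / N)" using K(4) by (intro sum_mono) auto
    also have "\<dots> = \<delta>" using N by (simp add: N_def)
    finally show "prob {p \<in> space M. ?e p \<noteq> None} \<le> \<delta>" .
  qed
  hence "label_entropy M ?e \<le> \<eta>" using \<delta>(2) unfolding N_def by linarith
  with J0 show thesis by (rule that)
qed

text \<open>The guesses along \<open>n\<close> steps are read off \<open>n + l\<close> cell labels,
  the errors cost at most \<open>\<eta>\<close> per step, heights cost a logarithm, and the coin
  word is cut into blocks of length \<open>m\<close>.\<close>

lemma label_entropy_itinerary_cell_of_le:
  assumes P: "measurable_partition M P" and "\<eta> > 0" and m: "m > 0"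
  obtains J l :: nat where "J > 0" "\<And>n. label_entropy M (itinerary T (cell_of P) n) \<le>
      n * (label_entropy M (itinerary T upper m) / m + \<eta>) + (m + l) * ln 2 + ln (real ((n + l) * J + 1))"
proof -
  obtain J l :: nat and G where J: "J > 0" and
    small: "label_entropy M (\<lambda>p. if cell_of P p = G (itinerary T (cell_label J) l p) then None else Some (cell_of P p)) \<le> \<eta>"
    by (rule approximate_by_cells[OF P \<open>\<eta> > 0\<close>])
  define f where "f = cell_of P"
  define g where "g p = G (itinerary T (cell_label J) l p)" for p
  define e where "e p = (if f p = g p then None else Some (f p))" for p
  note it = simple_function_itinerary
  have f: "simple_function M f" unfolding f_def by (rule simple_function_cell_of[OF P])
  have g: "simple_function M g" unfolding g_def
    by (rule simple_function_compose1[OF it[OF simple_function_cell_label]])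
  have e: "simple_function M e"
    using simple_function_compose1[OF simple_function_Pair[OF f g], where g = "\<lambda>(x, y). if x = y then None else Some x"]
    by (simp add: e_def[abs_def])
  have He: "label_entropy M e \<le> \<eta>" using small unfolding e_def[abs_def] f_def g_def by simp
  define h where "h = label_entropy M (itinerary T upper m)"
  have "label_entropy M (itinerary T f n) \<le>
      n * (h / m + \<eta>) + (m + l) * ln 2 + ln (real ((n + l) * J + 1))" for n
  proof -
    have "label_entropy M (itinerary T f n) \<le> label_entropy M (\<lambda>p. (itinerary T g n p, itinerary T e n p))"
    proof (rule label_entropy_le_of_determined[OF simple_function_Pair[OF it[OF g] it[OF e]] it[OF f], of UNIV])
      fix p q assume "(itinerary T g n p, itinerary T e n p) = (itinerary T g n q, itinerary T e n q)"
      hence *: "\<forall>k<n. g ((T ^^ k) p) = g ((T ^^ k) q)" "\<forall>k<n. e ((T ^^ k) p) = e ((T ^^ k) q)"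
        by (auto simp: itinerary_eq_iff)
      \<comment> \<open>The pair recovers \<open>f\<close>: the error label either certifies that
        the guess is right or carries the correct value itself.\<close>
      have "f ((T ^^ k) p) = f ((T ^^ k) q)" if "k < n" for k
        using *[rule_format, OF that] unfolding e_def by (auto split: if_splits)
      thus "itinerary T f n p = itinerary T f n q" by (simp add: itinerary_eq_iff)
    qed simp
    also have "\<dots> \<le> label_entropy M (itinerary T g n) + label_entropy M (itinerary T e n)"
      by (rule label_entropy_Pair_le[OF it[OF g] it[OF e]])
    also have "label_entropy M (itinerary T e n) \<le> n * label_entropy M e"
      by (rule label_entropy_itinerary_le[OF e])
    also have "n * label_entropy M e \<le> n * \<eta>" using He by (rule mult_left_mono) simp
    also have "label_entropy M (itinerary T g n) \<le> label_entropy M (itinerary T (cell_label J) (n + l))"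
    proof (rule label_entropy_le_of_determined[OF it[OF simple_function_cell_label] it[OF g], of UNIV])
      fix p q assume eq: "itinerary T (cell_label J) (n + l) p = itinerary T (cell_label J) (n + l) q"
      have "itinerary T (cell_label J) l ((T ^^ k) p) = itinerary T (cell_label J) l ((T ^^ k) q)"
        if "k < n" for k
      proof -
        have "(T ^^ a) ((T ^^ k) x) = (T ^^ (a + k)) x" for a x by (simp add: funpow_add)
        thus ?thesis using eq that by (simp add: itinerary_eq_iff)
      qed
      thus "itinerary T g n p = itinerary T g n q" by (simp add: itinerary_eq_iff[of T g] g_def)
    qed simp
    also have "\<dots> \<le> label_entropy M (itinerary T upper (n + l)) + ln (real ((n + l) * J + 1))"
      by (rule label_entropy_cells_le)
    also have "label_entropy M (itinerary T upper (n + l)) \<le> n * (h / m) + (m + l) * ln 2"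
    proof -
      \<comment> \<open>Only complete blocks of length \<open>m\<close> enjoy the rate
        \<open>h / m\<close>; the remainder and the \<open>l\<close> letters of look-ahead are
        charged \<open>ln 2\<close> each.\<close>
      have nl: "n + l = n div m * m + (n mod m + l)" by simp
      have "label_entropy M (itinerary T upper (n + l))
          \<le> label_entropy M (itinerary T upper (n div m * m)) + label_entropy M (itinerary T upper (n mod m + l))"
        using label_entropy_itinerary_add[OF simple_function_upper, of "n div m * m" "n mod m + l"]
        unfolding nl[symmetric] .
      also have "label_entropy M (itinerary T upper (n div m * m)) \<le> (n div m) * h"
        unfolding h_def by (rule label_entropy_itinerary_mult[OF simple_function_upper])
      also have "(n div m) * h \<le> n / m * h"
      proof (rule mult_right_mono)
        show "real (n div m) \<le> n / m" by (rule of_nat_div_le_of_nat)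
        show "h \<ge> 0" unfolding h_def
          by (rule label_entropy_ge[OF it[OF simple_function_upper]]) simp
      qed
      also have "label_entropy M (itinerary T upper (n mod m + l)) \<le> (n mod m + l) * ln 2"
        by (rule label_entropy_upper_le)
      also have "(n mod m + l) * ln 2 \<le> (m + l) * ln (2::real)"
        using m by (intro mult_right_mono) (auto intro: less_imp_le)
      finally show ?thesis by simp
    qed
    finally show ?thesis by (simp add: algebra_simps)
  qed
  thus thesis using that J unfolding f_def h_def by blast
qed

text \<open>The extra costs are sublinear in \<open>n\<close> and \<open>\<eta>\<close> is
  arbitrary, so one and the same \<open>m\<close> bounds every partition. A deficit at a single
  block length thereby survives the supremum over partitions.\<close>

lemma ks_entropy_le:
  assumes m: "m > 0"
  shows "ks_entropy T M \<le> ereal (label_entropy M (itinerary T upper m) / m)"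
  unfolding ks_entropy_def
proof (rule SUP_least)
  fix P assume "P \<in> {P. measurable_partition M P}"
  hence P: "measurable_partition M P" by simp
  hence part: "partition_on (space M) P" by (simp add: measurable_partition_def)
  define c where "c = label_entropy M (itinerary T upper m) / m"
  show "entropy_wrt_partition T M P \<le> ereal c"
  proof (rule ereal_le_epsilon2)
    fix \<eta> :: real assume "\<eta> > 0"
    then obtain J l :: nat where J: "J > 0" and le: "\<And>n. label_entropy M (itinerary T (cell_of P) n) \<le>
        n * (c + \<eta>) + (m + l) * ln 2 + ln (real ((n + l) * J + 1))"
      using label_entropy_itinerary_cell_of_le[OF P _ m, of \<eta>] unfolding c_def by blast
    define b where "b n = (c + \<eta>) + ((m + l) * ln 2 / n + ln (real ((n + l) * J + 1)) / n)" for n :: nat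
    have "entropy_wrt_partition T M P \<le> limsup (\<lambda>n. ereal (b n))"
      unfolding entropy_wrt_partition_def partition_entropy_iterated_join[OF part]
    proof (rule Limsup_mono, rule eventually_mono[OF eventually_gt_at_top[of 0]])
      fix n :: nat assume "n > 0"
      thus "ereal (label_entropy M (itinerary T (cell_of P) n) / real n) \<le> ereal (b n)"
        using divide_right_mono[OF le[of n], of "real n"] by (simp add: b_def add_divide_distrib)
    qed
    also have "\<dots> = ereal (c + \<eta>)"
    proof (rule lim_imp_Limsup)
      have "(\<lambda>n. real (m + l) * ln 2 / real n + ln (real ((n + l) * J + 1)) / real n) \<longlonglongrightarrow> 0"
        unfolding of_nat_add of_nat_mult of_nat_1 using J by real_asymp
      hence "b \<longlonglongrightarrow> (c + \<eta>) + 0"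
        unfolding b_def[abs_def] by (intro tendsto_add tendsto_const)
      thus "(\<lambda>n. ereal (b n)) \<longlonglongrightarrow> ereal (c + \<eta>)" by simp
    qed simp
    finally show "entropy_wrt_partition T M P \<le> ereal c + ereal \<eta>" by simp
  qed
qed

lemma ks_entropy_less: "ks_entropy T M < ereal (ln 2)"
proof -
  obtain m where m: "m > 0" "label_entropy M (itinerary T upper m) < m * ln 2"
    using ex_label_entropy_upper_less by blast
  have "label_entropy M (itinerary T upper m) / m < ln 2" using m by (simp add: field_simps)
  hence "ereal (label_entropy M (itinerary T upper m) / m) < ereal (ln 2)" by simp
  with ks_entropy_le[OF m(1)] show ?thesis by (rule le_less_trans)
qed

end

theorem corollary1p4:
  assumes "CARD('n::finite) \<ge> 2"
  shows "\<exists>T :: real ^ 'n \<Rightarrow> real ^ 'n.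
    T \<in> unit_cube \<rightarrow> unit_cube \<and>
    piecewise_affine_on unit_cube T \<and>
    continuous_on unit_cube T \<and>
    topological_entropy T unit_cube = ereal (ln 2) \<and>
    (SUP \<mu>\<in>invariant_measures T unit_cube. ks_entropy T \<mu>) = ereal (ln 2) \<and>
    \<not> (\<exists>\<mu>. maximal_entropy_measure T unit_cube \<mu>)"
proof -
  obtain i j :: 'n where "i \<noteq> j"
  proof -
    have "\<not> card (UNIV :: 'n set) \<le> Suc 0" using assms by simp
    thus thesis using that by (auto simp: card_le_Suc0_iff_eq)
  qed
  then interpret cone_map i j by unfold_locales
  have less: "ks_entropy T \<mu> < ereal (ln 2)" if "\<mu> \<in> invariant_measures T unit_cube" for \<mu>
  proof -
    interpret invariant_cone_measure i j \<mu> by unfold_locales (rule that)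
    show ?thesis by (rule ks_entropy_less)
  qed
  have top: "topological_entropy T unit_cube = ereal (ln 2)"
    by (rule antisym[OF topological_entropy_T_le topological_entropy_T_ge])
  have sup: "(SUP \<mu>\<in>invariant_measures T unit_cube. ks_entropy T \<mu>) = ereal (ln 2)"
    by (rule antisym[OF SUP_least SUP_ks_entropy_ge]) (rule less_imp_le[OF less])
  have "\<not> (\<exists>\<mu>. maximal_entropy_measure T unit_cube \<mu>)"
    using less unfolding maximal_entropy_measure_def top by (metis less_irrefl)
  thus ?thesis
    using T_in_cube piecewise_affine_T continuous_T top sup by (intro exI[of _ T]) blast
qed

end
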